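(* Consider the hard-cluster flat model with parameters $(N,K,\tau)$, where $K=K_N$ and $\tau=\tau_N$ may depend on $N$ and asymptotics are as $N\to\infty$. (a) (Achievability) Strong detection is achieved by the interval test with window length $2\pi\tau$ and threshold $\gamma$ in either of the following two cases: (A1) $\gamma=K$ and $\displaystyle \frac{N^K\,\tau^{K-1}}{(K-1)!}\to 0$. (A2) There exist sequences $c_N\to\infty$ and $\gamma\equiv\gamma_N$ with $$\gamma_N = (N-K)\tau+K-c_N\sqrt{(N-K)\tau},\qquad \gamma_N\ge 1+(N-1)\tau\ \text{ for all sufficiently large } N,$$ such that $$\frac{(K-1)^2(1-\tau)^2}{(N-K)\tau}\to\infty$$ and $$\frac{\big(K(1-\tau)-c_N\sqrt{(N-K)\tau}\big)^2}{2N\tau+K(1-\tau)-c_N\sqrt{(N-K)\tau}}-\log N\to\infty .$$ (b) (Converse) If $\tau\le 1/2$ for all sufficiently large $N$ and $$\frac{2N\tau^2}{K^2}\left(1+\frac{K}{N\tau}\right)^{K+1}=o(1),$$ then weak detection is impossible.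
   Context: Hard-cluster flat model $(N,K,\tau)$, with $1\le K\le N$ an integer and $\tau\in(0,1)$: angles $X=(X_1,\dots,X_N)\in[0,2\pi)^N$ are observed. Under $H_0$ (law $\mathbb{Q}$) the $X_i$ are i.i.d. uniform on $[0,2\pi)$. Under $H_1$ (law $\mathbb{P}$), a subset $S^*\subset[N]$ is drawn uniformly at random among subsets of size $K$, a phase $\Theta^*$ is drawn independently and uniformly on $[0,2\pi)$, and given $(S^*,\Theta^* )$ the $X_i$ are independent with $X_i$ uniform on the arc $[\Theta^*,\Theta^*+2\pi\tau]$ (mod $2\pi$) for $i\in S^*$ and $X_i$ uniform on $[0,2\pi)$ for $i\notin S^*$. $\mathbb{P}$ is the resulting mixture law of $X$. All arcs are understood modulo $2\pi$. A test is a measurable function $\phi$ of the data with values in $\{0,1\}$ ($1$ means reject $H_0$). $p_{\mathrm{fa}}(\phi)=\mathbb{Q}\{\phi(X)=1\}$ and $p_{\mathrm{miss}}(\phi)=\mathbb{P}\{\phi(X)=0\}$. A sequence of tests achieves strong detection if both $p_{\mathrm{fa}}\to0$ and $p_{\mathrm{miss}}\to0$. Weak detection is impossible if every sequence of tests satisfies $p_{\mathrm{fa}}+p_{\mathrm{miss}}\ge 1-o(1)$; equivalently the total variation distance between $\mathbb{P}$ and $\mathbb{Q}$ tends to $0$. Interval test with window length $2\pi\tau$ and threshold $\gamma$: reject $H_0$ if and only if $\sup_{\theta\in[0,2\pi)}\sum_{i=1}^N\mathbf{1}\{X_i\in[\theta,\theta+2\pi\tau]\}\ge\gamma$. $\log$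 is the natural logarithm. *)

theory Defs
  imports "HOL-Probability.Probability"
begin

definition circle :: "real measure" where
  "circle = restrict_space lborel {0..<2 * pi}"

definition uniform_angle :: "real measure" where
  "uniform_angle = uniform_measure circle (space circle)"

text \<open>The closed arc from \<open>\<theta>\<close> to \<open>\<theta> + 2\<pi>\<tau>\<close> modulo \<open>2\<pi>\<close>, as a subset of \<open>[0, 2\<pi>)\<close>.\<close>

definition circ_arc :: "real \<Rightarrow> real \<Rightarrow> real set" where
  "circ_arc \<tau> \<theta> =
     {x \<in> {0..<2 * pi}. \<exists>k::int. x + 2 * pi * of_int k \<in> {\<theta>..\<theta> + 2 * pi * \<tau>}}"

text \<open>A sample of \<open>N\<close> angles is a function on the index set \<open>{..<N}\<close>.\<close>

definition H0_law :: "nat \<Rightarrow> (nat \<Rightarrow> real) measure" where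
  "H0_law N = (\<Pi>\<^sub>M i\<in>{..<N}. uniform_angle)"

definition H1_law :: "nat \<Rightarrow> nat \<Rightarrow> real \<Rightarrow> (nat \<Rightarrow> real) measure" where
  "H1_law N K \<tau> =
     bind (measure_pmf (pmf_of_set {S. S \<subseteq> {..<N} \<and> card S = K})) (\<lambda>S.
     bind uniform_angle (\<lambda>\<theta>.
       (\<Pi>\<^sub>M i\<in>{..<N}. if i \<in> S then uniform_measure circle (circ_arc \<tau> \<theta>) else uniform_angle)))"

text \<open>The value \<open>True\<close> of a test means that the null hypothesis is rejected.\<close>

definition is_test :: "nat \<Rightarrow> ((nat \<Rightarrow> real) \<Rightarrow> bool) \<Rightarrow> bool" where
  "is_test N \<phi> \<longleftrightarrow> \<phi> \<in> measurable (\<Pi>\<^sub>M i\<in>{..<N}. circle) (count_space UNIV)"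

definition p_fa :: "nat \<Rightarrow> ((nat \<Rightarrow> real) \<Rightarrow> bool) \<Rightarrow> real" where
  "p_fa N \<phi> = measure (H0_law N) {x \<in> space (H0_law N). \<phi> x}"

definition p_miss :: "nat \<Rightarrow> nat \<Rightarrow> real \<Rightarrow> ((nat \<Rightarrow> real) \<Rightarrow> bool) \<Rightarrow> real" where
  "p_miss N K \<tau> \<phi> = measure (H1_law N K \<tau>) {x \<in> space (H1_law N K \<tau>). \<not> \<phi> x}"

definition strong_detection ::
  "(nat \<Rightarrow> nat) \<Rightarrow> (nat \<Rightarrow> real) \<Rightarrow> (nat \<Rightarrow> (nat \<Rightarrow> real) \<Rightarrow> bool) \<Rightarrow> bool" where
  "strong_detection K \<tau> \<phi> \<longleftrightarrow>
     (\<forall>N. is_test N (\<phi> N)) \<and>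
     (\<lambda>N. p_fa N (\<phi> N)) \<longlonglongrightarrow> 0 \<and>
     (\<lambda>N. p_miss N (K N) (\<tau> N) (\<phi> N)) \<longlonglongrightarrow> 0"

definition weak_detection_impossible :: "(nat \<Rightarrow> nat) \<Rightarrow> (nat \<Rightarrow> real) \<Rightarrow> bool" where
  "weak_detection_impossible K \<tau> \<longleftrightarrow>
     (\<forall>\<phi>. (\<forall>N. is_test N (\<phi> N)) \<longrightarrow>
       (\<exists>r. r \<longlonglongrightarrow> 0 \<and>
         (\<forall>N\<ge>1. p_fa N (\<phi> N) + p_miss N (K N) (\<tau> N) (\<phi> N) \<ge> 1 - r N)))"

definition interval_test :: "nat \<Rightarrow> real \<Rightarrow> real \<Rightarrow> (nat \<Rightarrow> real) \<Rightarrow> bool" where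
  "interval_test N \<tau> \<gamma> x \<longleftrightarrow>
     (SUP \<theta>\<in>{0..<2 * pi}. \<Sum>i<N. indicat_real (circ_arc \<tau> \<theta>) (x i)) \<ge> \<gamma>"

end

theory Submission
  imports Defs
begin

text \<open>Write \<open>\<nu>\<close> for the uniform law on the circle and \<open>Q\<close> for the null law, its \<open>N\<close>-fold power.
Given the planted set \<open>S\<close> and the phase \<open>\<theta>\<close>, the alternative has density
\<open>\<Prod>i\<in>S. 1[x i \<in> arc \<theta>] / \<tau>\<close> with respect to \<open>Q\<close> (\<open>PiM_planted_eq_density\<close>), because every arc has
\<open>\<nu>\<close>-measure \<open>\<tau>\<close> by rotation invariance. All probabilities and moments below therefore become
\<open>Q\<close>-integrals of products over coordinates, and factorize.

\<^emph>\<open>Achievability.\<close> A window that contains data points can be slid forward until it starts at the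
first of them, and it loses none of them. Hence the scan statistic is a maximum over the \<open>N\<close> windows that
start at a data point, and under \<open>Q\<close> the number of other points in such a window is binomial with
parameters \<open>N - 1\<close> and \<open>\<tau>\<close>. A union bound over the \<open>N\<close> windows costs a factor \<open>N\<close>. For the threshold
\<open>K\<close> the binomial tail is bounded by the expected number of \<open>(K - 1)\<close>-subsets in the window
(\<open>neighbour_count_union_bound\<close>), and the planted window itself always reaches the threshold, so no
planted sample is missed. For the threshold \<open>\<gamma>\<close> both errors are controlled by exponential moments
(\<open>neighbour_count_upper_tail\<close>, \<open>p_miss_chernoff\<close>): a miss forces the number of
unplanted points in the planted window below its mean by \<open>c\<close> times the square root of that mean, which
has probability at most \<open>exp (- c\<^sup>2 / 2)\<close>. The false alarm exponent falls short of the one in the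
hypothesis by at most \<open>2\<close> (\<open>chernoff_exponent_shift\<close>).

\<^emph>\<open>Converse.\<close> Two independent copies \<open>(S, \<theta>)\<close>, \<open>(S', \<theta>')\<close> of the planted parameters give the second moment of
the mixture likelihood \<open>L\<close>. For \<open>h = |S \<inter> S'|\<close> the coordinates contribute
\<open>(\<nu> (arc \<theta> \<inter> arc \<theta>') / \<tau>\<^sup>2) ^ h\<close>. The overlap of two arcs of length \<open>2\<pi>\<tau> \<le> \<pi>\<close> is a tent function of
\<open>\<theta>' - \<theta>\<close>, so averaging over the phases gives at most \<open>2 \<tau> / (\<tau> ^ h (h + 1))\<close> for \<open>h \<ge> 1\<close>
(\<open>nn_integral_overlap_power\<close>). Averaging over \<open>S'\<close>, a given \<open>T \<subseteq> S\<close> lies in \<open>S'\<close> with probability at most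
\<open>(K / N) ^ |T|\<close>, and the resulting sum over \<open>T\<close> is, up to a factor, part of the binomial expansion of
\<open>(1 + K / (N \<tau>)) ^ (K + 1)\<close> (\<open>overlap_series_le\<close>). So the hypothesis says that a bound on the
variance of \<open>L\<close> tends to \<open>0\<close>, and by Cauchy--Schwarz no test separates the two laws.\<close>

section \<open>The uniform law on the circle and its arcs\<close>

lemma space_circle [simp]: "space circle = {0..<2 * pi}"
  by (simp add: circle_def space_restrict_space)

lemma sets_circle [measurable_cong]: "sets circle = sets (restrict_space borel {0..<2 * pi})"
  by (simp add: circle_def sets_restrict_space)

lemma space_uniform_angle [simp]: "space uniform_angle = {0..<2 * pi}"
  by (simp add: uniform_angle_def)

lemma sets_uniform_angle [simp, measurable_cong]: "sets uniform_angle = sets circle"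
  by (simp add: uniform_angle_def)

lemma emeasure_circle_space: "emeasure circle {0..<2 * pi} = ennreal (2 * pi)"
  by (simp add: circle_def emeasure_restrict_space)

lemma prob_space_uniform_angle: "prob_space uniform_angle"
  unfolding uniform_angle_def
  by (rule prob_space_uniform_measure) (auto simp: emeasure_circle_space)

text \<open>Lets the Borel calculus be used for functions into the circle, whose sigma-algebra lives on
\<open>[0, 2\<pi>)\<close> only.\<close>

lemma measurable_circle_borel:
  assumes "f \<in> measurable M circle"
  shows "f \<in> borel_measurable M"
proof -
  have "f \<in> measurable M (restrict_space borel {0..<2 * pi})"
    using assms by (simp add: sets_circle cong: measurable_cong_sets)
  thus ?thesis by (simp add: measurable_restrict_space2_iff)
qed

lemma nn_integral_uniform_angle:
  assumes f: "f \<in> borel_measurable circle"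
  shows "(\<integral>\<^sup>+x. f x \<partial>uniform_angle) =
    ennreal (1 / (2 * pi)) * (\<integral>\<^sup>+x. f x * indicator {0..<2 * pi} x \<partial>lborel)"
proof -
  have "(\<integral>\<^sup>+x. f x \<partial>uniform_angle)
      = (\<integral>\<^sup>+x. f x * indicator {0..<2 * pi} x \<partial>circle) / ennreal (2 * pi)"
    unfolding uniform_angle_def
    using nn_integral_uniform_measure[OF f sets.top] by (simp add: emeasure_circle_space)
  also have "(\<integral>\<^sup>+x. f x * indicator {0..<2 * pi} x \<partial>circle)
      = (\<integral>\<^sup>+x. f x * indicator {0..<2 * pi} x \<partial>lborel)"
    unfolding circle_def
    by (subst nn_integral_restrict_space)
       (auto intro!: nn_integral_cong simp: indicator_def)
  finally show ?thesis
    by (simp only: divide_ennreal_def) (simp add: inverse_ennreal inverse_eq_divide mult.commute)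
qed

lemma circ_arc_subset: "circ_arc \<tau> \<theta> \<subseteq> {0..<2 * pi}"
  by (auto simp: circ_arc_def)

text \<open>The arc may start at a random angle, so measurability is needed jointly in the point and in the
left end. It holds because the condition is a countable union, over the winding number, of pairs
of inequalities.\<close>

lemma measurable_mem_circ_arc [measurable (raw)]:
  assumes f: "f \<in> measurable M circle" and g: "g \<in> measurable M circle"
  shows "Measurable.pred M (\<lambda>z. f z \<in> circ_arc \<tau> (g z))"
proof -
  have [measurable]: "f \<in> borel_measurable M" "g \<in> borel_measurable M"
    using f g by (auto intro: measurable_circle_borel)
  have "Measurable.pred M (\<lambda>z. \<exists>k::int. g z \<le> f z + 2 * pi * of_int k \<and>
          f z + 2 * pi * of_int k \<le> g z + 2 * pi * \<tau>)"
    by measurable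
  moreover have "f z \<in> circ_arc \<tau> (g z) \<longleftrightarrow> (\<exists>k::int. g z \<le> f z + 2 * pi * of_int k \<and>
          f z + 2 * pi * of_int k \<le> g z + 2 * pi * \<tau>)" if "z \<in> space M" for z
    using measurable_space[OF f that] by (simp add: circ_arc_def)
  ultimately show ?thesis
    by (rule measurable_cong[THEN iffD2, rotated])
qed

lemma circ_arc_sets [measurable]:
  assumes "\<theta> \<in> {0..<2 * pi}"
  shows "circ_arc \<tau> \<theta> \<in> sets circle"
proof -
  have [measurable]: "(\<lambda>x. \<theta>) \<in> measurable circle circle"
    using assms by (intro measurable_const) simp
  have "{x \<in> space circle. x \<in> circ_arc \<tau> \<theta>} \<in> sets circle"
    by measurable
  also have "{x \<in> space circle. x \<in> circ_arc \<tau> \<theta>} = circ_arc \<tau> \<theta>"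
    using circ_arc_subset[of \<tau> \<theta>] by auto
  finally show ?thesis .
qed

definition rotate_angle :: "real \<Rightarrow> real \<Rightarrow> real" where
  "rotate_angle \<theta> x = (if x + \<theta> < 2 * pi then x + \<theta> else x + \<theta> - 2 * pi)"

lemma rotate_angle_range:
  "\<theta> \<in> {0..<2 * pi} \<Longrightarrow> x \<in> {0..<2 * pi} \<Longrightarrow> rotate_angle \<theta> x \<in> {0..<2 * pi}"
  by (auto simp: rotate_angle_def)

lemma rotate_angle_0: "x \<in> {0..<2 * pi} \<Longrightarrow> rotate_angle x 0 = x"
  by (simp add: rotate_angle_def)

lemma measurable_rotate_angle:
  assumes "\<theta> \<in> {0..<2 * pi}"
  shows "rotate_angle \<theta> \<in> measurable circle circle"
proof -
  have [measurable]: "(\<lambda>x. x) \<in> borel_measurable circle"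
    by (rule measurable_circle_borel) simp
  have "rotate_angle \<theta> \<in> measurable circle (restrict_space borel {0..<2 * pi})"
  proof (rule measurable_restrict_space2)
    show "rotate_angle \<theta> \<in> borel_measurable circle"
      unfolding rotate_angle_def by measurable
  qed (use rotate_angle_range assms in auto)
  thus ?thesis by (simp add: sets_circle cong: measurable_cong_sets)
qed

text \<open>The circle is cut at \<open>2\<pi> - \<theta>\<close>: rotation is a translation on each of the
two pieces, and the images \<open>[\<theta>, 2\<pi>)\<close> and \<open>[0, \<theta>)\<close> tile
the circle again.\<close>

lemma nn_integral_rotate_angle:
  assumes \<theta>: "\<theta> \<in> {0..<2 * pi}" and f: "f \<in> borel_measurable circle"
  shows "(\<integral>\<^sup>+x. f (rotate_angle \<theta> x) \<partial>uniform_angle) = (\<integral>\<^sup>+x. f x \<partial>uniform_angle)"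
proof -
  define g where "g x = f x * indicator {0..<2 * pi} x" for x
  have g [measurable]: "g \<in> borel_measurable borel"
    using f unfolding g_def
    by (subst borel_measurable_restrict_space_iff_ennreal[symmetric])
       (auto simp: sets_circle cong: measurable_cong_sets)
  have shift: "(\<integral>\<^sup>+x. h (x + t) \<partial>lborel) = (\<integral>\<^sup>+x. h x \<partial>lborel)"
    if "h \<in> borel_measurable borel" for h :: "real \<Rightarrow> ennreal" and t
    using nn_integral_real_affine[OF that, of 1 t] by (simp add: add.commute)
  have "(\<integral>\<^sup>+x. f (rotate_angle \<theta> x) * indicator {0..<2 * pi} x \<partial>lborel)
      = (\<integral>\<^sup>+x. g (x + \<theta>) * indicator {\<theta>..<2 * pi} (x + \<theta>) +
              g (x + (\<theta> - 2 * pi)) * indicator {0..<\<theta>} (x + (\<theta> - 2 * pi)) \<partial>lborel)"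
    using \<theta> by (intro nn_integral_cong) (auto simp: g_def rotate_angle_def indicator_def algebra_simps)
  also have "\<dots> = (\<integral>\<^sup>+x. g (x + \<theta>) * indicator {\<theta>..<2 * pi} (x + \<theta>) \<partial>lborel) +
       (\<integral>\<^sup>+x. g (x + (\<theta> - 2 * pi)) * indicator {0..<\<theta>} (x + (\<theta> - 2 * pi)) \<partial>lborel)"
    by (rule nn_integral_add) measurable
  also have "\<dots> = (\<integral>\<^sup>+x. g x * indicator {\<theta>..<2 * pi} x \<partial>lborel) +
       (\<integral>\<^sup>+x. g x * indicator {0..<\<theta>} x \<partial>lborel)"
    by (subst (1 2) shift[of "\<lambda>x. g x * indicator _ x"]) auto
  also have "\<dots> = (\<integral>\<^sup>+x. g x * indicator {\<theta>..<2 * pi} x + g x * indicator {0..<\<theta>} x \<partial>lborel)"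
    by (rule nn_integral_add[symmetric]) measurable
  also have "\<dots> = (\<integral>\<^sup>+x. f x * indicator {0..<2 * pi} x \<partial>lborel)"
    using \<theta> by (intro nn_integral_cong) (auto simp: g_def indicator_def)
  finally show ?thesis
    using f measurable_compose[OF measurable_rotate_angle[OF \<theta>] f]
    by (simp add: nn_integral_uniform_angle)
qed

text \<open>Rotation changes angles by \<open>\<theta>\<close> up to whole turns, and arcs are only defined up
to whole turns. Together with rotation invariance this reduces questions about two arcs to the
case where one of them starts at \<open>0\<close>.\<close>

lemma circ_arc_rotate_angle:
  assumes "\<theta> \<in> {0..<2 * pi}" "x \<in> {0..<2 * pi}"
  shows "rotate_angle \<theta> x \<in> circ_arc \<tau> (rotate_angle \<theta> \<phi>) \<longleftrightarrow> x \<in> circ_arc \<tau> \<phi>"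
proof -
  have ex: "\<exists>k::int. rotate_angle \<theta> y = y + \<theta> + 2 * pi * of_int k" for y
    by (rule exI[of _ "if y + \<theta> < 2 * pi then 0 else - 1"]) (simp add: rotate_angle_def)
  obtain k l :: int where k: "rotate_angle \<theta> x = x + \<theta> + 2 * pi * of_int k"
    and l: "rotate_angle \<theta> \<phi> = \<phi> + \<theta> + 2 * pi * of_int l"
    using ex[of x] ex[of \<phi>] by blast
  have "(\<exists>m::int. rotate_angle \<theta> x + 2 * pi * of_int m \<in>
            {rotate_angle \<theta> \<phi>..rotate_angle \<theta> \<phi> + 2 * pi * \<tau>}) \<longleftrightarrow>
        (\<exists>m::int. x + 2 * pi * of_int m \<in> {\<phi>..\<phi> + 2 * pi * \<tau>})" (is "(\<exists>m. ?P m) \<longleftrightarrow> (\<exists>m. ?Q m)")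
  proof
    assume "\<exists>m. ?P m"
    then obtain m where "?P m" ..
    hence "?Q (m + k - l)" by (auto simp: k l algebra_simps)
    thus "\<exists>m. ?Q m" ..
  next
    assume "\<exists>m. ?Q m"
    then obtain m where "?Q m" ..
    hence "?P (m - k + l)" by (auto simp: k l algebra_simps)
    thus "\<exists>m. ?P m" ..
  qed
  thus ?thesis using assms rotate_angle_range[of \<theta> x] by (simp add: circ_arc_def)
qed

text \<open>Only the winding numbers \<open>0\<close> and \<open>1\<close> can occur for an arc shorter than a
full turn; the second piece is the part that wraps around past \<open>2\<pi>\<close>.\<close>

lemma circ_arc_eq:
  assumes "\<phi> \<in> {0..<2 * pi}" "\<tau> < 1"
  shows "circ_arc \<tau> \<phi> = ({\<phi>..\<phi> + 2 * pi * \<tau>} \<union> {..\<phi> + 2 * pi * \<tau> - 2 * pi}) \<inter> {0..<2 * pi}"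
proof -
  have small: "k = 0 \<or> k = 1"
    if x: "x \<in> {0..<2 * pi}" and k: "\<phi> \<le> x + 2 * pi * of_int k" "x + 2 * pi * of_int k \<le> \<phi> + 2 * pi * \<tau>"
    for x and k :: int
  proof -
    have "2 * pi * (-1) < 2 * pi * of_int k"
      using assms x k unfolding atLeastLessThan_iff by linarith
    hence "(-1::real) < of_int k" by (subst (asm) mult_less_cancel_left_pos) auto
    moreover have "2 * pi * \<tau> < 2 * pi * 1" using assms by simp
    hence "2 * pi * of_int k < 2 * pi * 2"
      using assms x k unfolding atLeastLessThan_iff by linarith
    hence "of_int k < (2::real)" by (subst (asm) mult_less_cancel_left_pos) auto
    ultimately show ?thesis by linarith
  qed
  show ?thesis
  proof (intro equalityI subsetI)
    fix x assume x: "x \<in> circ_arc \<tau> \<phi>"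
    then obtain k :: int where "x + 2 * pi * of_int k \<in> {\<phi>..\<phi> + 2 * pi * \<tau>}" and "x \<in> {0..<2 * pi}"
      by (auto simp: circ_arc_def)
    with small[of x k] show "x \<in> ({\<phi>..\<phi> + 2 * pi * \<tau>} \<union> {..\<phi> + 2 * pi * \<tau> - 2 * pi}) \<inter> {0..<2 * pi}"
      by auto
  next
    fix x assume "x \<in> ({\<phi>..\<phi> + 2 * pi * \<tau>} \<union> {..\<phi> + 2 * pi * \<tau> - 2 * pi}) \<inter> {0..<2 * pi}"
    hence "x \<in> {0..<2 * pi}" and
      "x + 2 * pi * of_int 0 \<in> {\<phi>..\<phi> + 2 * pi * \<tau>} \<or> x + 2 * pi * of_int 1 \<in> {\<phi>..\<phi> + 2 * pi * \<tau>}"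
      using assms by auto
    thus "x \<in> circ_arc \<tau> \<phi>" unfolding circ_arc_def by blast
  qed
qed

lemma emeasure_uniform_angle:
  assumes "A \<in> sets circle"
  shows "emeasure uniform_angle A = ennreal (1 / (2 * pi)) * emeasure lborel A"
proof -
  have "A \<subseteq> {0..<2 * pi}" using sets.sets_into_space[OF assms] by simp
  hence *: "indicator A x * indicator {0..<2 * pi} x = (indicator A x :: ennreal)" for x
    by (auto simp: indicator_def)
  have "A \<in> sets borel" using assms by (auto simp: sets_circle sets_restrict_space)
  moreover have "emeasure uniform_angle A = (\<integral>\<^sup>+x. indicator A x \<partial>uniform_angle)"
    using assms by simp
  ultimately show ?thesis
    using assms by (simp add: nn_integral_uniform_angle * del: nn_integral_indicator)
       (simp)
qed

lemma emeasure_circle: "A \<in> sets circle \<Longrightarrow> emeasure circle A = emeasure lborel A"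
  using sets.sets_into_space[of A circle] by (simp add: circle_def emeasure_restrict_space space_restrict_space)

lemma emeasure_uniform_angle_rotate:
  assumes \<theta>: "\<theta> \<in> {0..<2 * pi}" and A: "A \<in> sets circle"
  shows "emeasure uniform_angle {x \<in> {0..<2 * pi}. rotate_angle \<theta> x \<in> A} = emeasure uniform_angle A"
proof -
  have "{x \<in> {0..<2 * pi}. rotate_angle \<theta> x \<in> A} \<in> sets circle"
    using measurable_sets[OF measurable_rotate_angle[OF \<theta>] A]
    by (simp add: vimage_def Int_def conj_commute)
  hence "emeasure uniform_angle {x \<in> {0..<2 * pi}. rotate_angle \<theta> x \<in> A}
      = (\<integral>\<^sup>+x. indicator {x \<in> {0..<2 * pi}. rotate_angle \<theta> x \<in> A} x \<partial>uniform_angle)"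
    by simp
  also have "\<dots> = (\<integral>\<^sup>+x. indicator A (rotate_angle \<theta> x) \<partial>uniform_angle)"
    by (intro nn_integral_cong) (auto simp: indicator_def)
  also have "\<dots> = (\<integral>\<^sup>+x. indicator A x \<partial>uniform_angle)"
    using A by (intro nn_integral_rotate_angle \<theta> borel_measurable_indicator)
  finally show ?thesis using A by simp
qed

lemma emeasure_circ_arc:
  assumes \<theta>: "\<theta> \<in> {0..<2 * pi}" and \<tau>: "0 < \<tau>" "\<tau> < 1"
  shows "emeasure uniform_angle (circ_arc \<tau> \<theta>) = ennreal \<tau>"
proof -
  define a where "a = 2 * pi * \<tau>"
  have "0 < a" "a < 2 * pi" using \<tau> by (auto simp: a_def)
  hence arc0: "circ_arc \<tau> 0 = {0..2 * pi * \<tau>}"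
    using \<tau> unfolding a_def[symmetric] by (subst circ_arc_eq) (auto simp: a_def[symmetric])
  have "emeasure uniform_angle (circ_arc \<tau> \<theta>)
      = emeasure uniform_angle {x \<in> {0..<2 * pi}. rotate_angle \<theta> x \<in> circ_arc \<tau> \<theta>}"
    by (rule emeasure_uniform_angle_rotate[OF \<theta> circ_arc_sets[OF \<theta>], symmetric])
  also have "{x \<in> {0..<2 * pi}. rotate_angle \<theta> x \<in> circ_arc \<tau> \<theta>} = circ_arc \<tau> 0"
    using circ_arc_rotate_angle[OF \<theta>, of _ \<tau> 0] circ_arc_subset[of \<tau> 0] rotate_angle_0[OF \<theta>] by auto
  also have "emeasure uniform_angle (circ_arc \<tau> 0) = ennreal \<tau>"
  proof -
    have "{0..2 * pi * \<tau>} \<in> sets circle"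
      using circ_arc_sets[of 0 \<tau>] arc0 by simp
    hence "emeasure uniform_angle {0..2 * pi * \<tau>} = ennreal (1 / (2 * pi)) * ennreal (2 * pi * \<tau>)"
      using \<tau> by (simp only: emeasure_uniform_angle) simp
    also have "\<dots> = ennreal (1 / (2 * pi) * (2 * pi * \<tau>))"
      using \<tau> by (intro ennreal_mult[symmetric]) auto
    finally show ?thesis by (simp add: arc0)
  qed
  finally show ?thesis .
qed

lemma measurable_overlap:
  assumes \<theta>: "\<theta> \<in> {0..<2 * pi}"
  shows "(\<lambda>\<theta>'. emeasure uniform_angle (circ_arc \<tau> \<theta> \<inter> circ_arc \<tau> \<theta>')) \<in> borel_measurable circle"
proof -
  interpret prob_space uniform_angle by (rule prob_space_uniform_angle)
  have [measurable]: "(\<lambda>x. \<theta>) \<in> measurable M circle" for M :: "(real \<times> real) measure"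
    using \<theta> by (intro measurable_const) simp
  have "{p \<in> space (circle \<Otimes>\<^sub>M uniform_angle). snd p \<in> circ_arc \<tau> \<theta> \<and> snd p \<in> circ_arc \<tau> (fst p)}
      \<in> sets (circle \<Otimes>\<^sub>M uniform_angle)" (is "?R \<in> _")
    by measurable
  hence "(\<lambda>\<theta>'. emeasure uniform_angle (Pair \<theta>' -` ?R)) \<in> borel_measurable circle"
    by (rule measurable_emeasure_Pair)
  moreover have "Pair \<theta>' -` ?R = circ_arc \<tau> \<theta> \<inter> circ_arc \<tau> \<theta>'" if "\<theta>' \<in> space circle" for \<theta>'
    using that circ_arc_subset[of \<tau> \<theta>] by (auto simp: space_pair_measure)
  ultimately show ?thesis
    by (subst measurable_cong[where g = "\<lambda>\<theta>'. emeasure uniform_angle (Pair \<theta>' -` ?R)"]) auto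
qed

text \<open>After a rotation \<open>\<theta> = 0\<close>. With \<open>a = 2\<pi>\<tau>\<close>, the arcs
starting at \<open>0\<close> and at \<open>\<phi>\<close> overlap in a segment of length \<open>a
- \<phi>\<close> if \<open>\<phi> \<le> a\<close>, and of length \<open>a - (2\<pi> -
\<phi>)\<close> if \<open>\<phi> \<ge> 2\<pi> - a\<close>. Since \<open>a \<le> \<pi>\<close>
these two ranges meet in at most one point, so the \<open>h\<close>-th power of the overlap is
bounded by the sum of the two \<open>h\<close>-th powers, each of which integrates to \<open>a ^
(h + 1) / (h + 1)\<close>.\<close>

lemma nn_integral_overlap_power:
  assumes \<tau>: "0 < \<tau>" "\<tau> \<le> 1 / 2" and h: "h \<ge> 1" and \<theta>: "\<theta> \<in> {0..<2 * pi}"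
  shows "(\<integral>\<^sup>+\<theta>'. emeasure uniform_angle (circ_arc \<tau> \<theta> \<inter> circ_arc \<tau> \<theta>') ^ h \<partial>uniform_angle)
    \<le> ennreal (2 * \<tau> ^ (h + 1) / (h + 1))"
proof -
  define a where "a = 2 * pi * \<tau>"
  have a: "0 < a" "a \<le> pi" using \<tau> by (auto simp: a_def)
  let ?I = "\<lambda>\<theta> \<theta>'. emeasure uniform_angle (circ_arc \<tau> \<theta> \<inter> circ_arc \<tau> \<theta>')"
  have arc0: "circ_arc \<tau> 0 = {0..a}"
    using a \<tau> by (subst circ_arc_eq) (auto simp: a_def[symmetric])
  have rot: "?I \<theta> (rotate_angle \<theta> \<phi>) = ?I 0 \<phi>" if \<phi>: "\<phi> \<in> {0..<2 * pi}" for \<phi>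
  proof -
    have "?I \<theta> (rotate_angle \<theta> \<phi>) = emeasure uniform_angle
        {x \<in> {0..<2 * pi}. rotate_angle \<theta> x \<in> circ_arc \<tau> \<theta> \<inter> circ_arc \<tau> (rotate_angle \<theta> \<phi>)}"
      using \<theta> \<phi> by (intro emeasure_uniform_angle_rotate[symmetric] sets.Int circ_arc_sets rotate_angle_range)
    also have "{x \<in> {0..<2 * pi}. rotate_angle \<theta> x \<in> circ_arc \<tau> \<theta> \<inter> circ_arc \<tau> (rotate_angle \<theta> \<phi>)}
        = circ_arc \<tau> 0 \<inter> circ_arc \<tau> \<phi>"
      using circ_arc_rotate_angle[OF \<theta>, of _ \<tau> 0] circ_arc_rotate_angle[OF \<theta>, of _ \<tau> \<phi>]
        circ_arc_subset[of \<tau> 0] rotate_angle_0[OF \<theta>] by auto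
    finally show ?thesis .
  qed
  have bound: "?I 0 \<phi> ^ h \<le>
      ennreal ((1 / (2 * pi)) ^ h) *
      (ennreal ((a - \<phi>) ^ h) * indicator {0..a} \<phi> +
       ennreal ((a - 2 * pi + \<phi>) ^ h) * indicator {2 * pi - a..2 * pi} \<phi>)"
    if \<phi>: "\<phi> \<in> {0..<2 * pi}" for \<phi>
  proof -
    have sub: "circ_arc \<tau> 0 \<inter> circ_arc \<tau> \<phi> \<subseteq> {\<phi>..a} \<union> {0..a - 2 * pi + \<phi>}"
      using \<phi> \<tau> a unfolding arc0 by (subst circ_arc_eq) (auto simp: a_def[symmetric])
    have s [simp]: "circ_arc \<tau> 0 \<inter> circ_arc \<tau> \<phi> \<in> sets circle"
      using \<phi> by (intro sets.Int circ_arc_sets) auto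
    have m: "?I 0 \<phi> ^ h \<le> ennreal ((1 / (2 * pi)) ^ h) * ennreal (l ^ h)"
      if "circ_arc \<tau> 0 \<inter> circ_arc \<tau> \<phi> \<subseteq> {u..u + l}" "l \<ge> 0" for u l
    proof -
      have "emeasure lborel (circ_arc \<tau> 0 \<inter> circ_arc \<tau> \<phi>) \<le> emeasure lborel {u..u + l}"
        using that by (intro emeasure_mono) auto
      also have "\<dots> = ennreal l" using that by simp
      finally have "?I 0 \<phi> \<le> ennreal (1 / (2 * pi)) * ennreal l"
        unfolding emeasure_uniform_angle[OF s] by (intro mult_left_mono) auto
      hence "?I 0 \<phi> ^ h \<le> (ennreal (1 / (2 * pi)) * ennreal l) ^ h"
        by (intro power_mono) auto
      also have "\<dots> = ennreal ((1 / (2 * pi)) ^ h) * ennreal (l ^ h)"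
        using that by (simp only: power_mult_distrib) (simp add: ennreal_power)
      finally show ?thesis .
    qed
    consider "\<phi> \<le> a" | "2 * pi - a \<le> \<phi>" "\<phi> > a" | "\<phi> > a" "\<phi> < 2 * pi - a" by linarith
    thus ?thesis
    proof cases
      case 1
      have "?I 0 \<phi> ^ h \<le> ennreal ((1 / (2 * pi)) ^ h) * ennreal ((a - \<phi>) ^ h)"
      proof (cases "\<phi> < 2 * pi - a")
        case True
        thus ?thesis using m[of \<phi> "a - \<phi>"] sub 1 by auto
      next
        case False
        \<comment> \<open>For \<open>\<tau> = 1 / 2\<close> antipodal arcs meet in both end points, which are null.\<close>
        hence "\<phi> = pi" "a = pi" using 1 a by auto
        hence "circ_arc \<tau> 0 \<inter> circ_arc \<tau> \<phi> \<subseteq> {pi} \<union> {0}" using sub by auto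
        hence "emeasure lborel (circ_arc \<tau> 0 \<inter> circ_arc \<tau> \<phi>) \<le> emeasure lborel {0, pi}"
          by (intro emeasure_mono) auto
        also have "\<dots> = 0" by (rule emeasure_lborel_countable) simp
        finally show ?thesis using h by (simp add: emeasure_uniform_angle zero_power)
      qed
      also have "\<dots> \<le> ennreal ((1 / (2 * pi)) ^ h) *
          (ennreal ((a - \<phi>) ^ h) * indicator {0..a} \<phi> +
           ennreal ((a - 2 * pi + \<phi>) ^ h) * indicator {2 * pi - a..2 * pi} \<phi>)"
        using 1 \<phi> by (intro mult_left_mono) auto
      finally show ?thesis .
    next
      case 2
      hence "?I 0 \<phi> ^ h \<le> ennreal ((1 / (2 * pi)) ^ h) * ennreal ((a - 2 * pi + \<phi>) ^ h)"
        using m[of 0 "a - 2 * pi + \<phi>"] sub by auto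
      also have "\<dots> \<le> ennreal ((1 / (2 * pi)) ^ h) *
          (ennreal ((a - \<phi>) ^ h) * indicator {0..a} \<phi> +
           ennreal ((a - 2 * pi + \<phi>) ^ h) * indicator {2 * pi - a..2 * pi} \<phi>)"
        using 2 \<phi> by (intro mult_left_mono) auto
      finally show ?thesis .
    next
      case 3
      thus ?thesis using m[of 0 0] sub h by (auto simp: zero_power)
    qed
  qed
  have "((\<lambda>x. - ((a - x) ^ (h + 1) / (h + 1))) has_real_derivative (a - x) ^ h) (at x)" for x
    by (auto intro!: derivative_eq_intros simp del: power_Suc)
  hence up: "(\<integral>\<^sup>+\<phi>. ennreal ((a - \<phi>) ^ h) * indicator {0..a} \<phi> \<partial>lborel) = ennreal (a ^ (h + 1) / (h + 1))"
    using a by (subst nn_integral_FTC_Icc[where F = "\<lambda>x. - ((a - x) ^ (h + 1) / (h + 1))"]) auto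
  have "((\<lambda>x. (a - 2 * pi + x) ^ (h + 1) / (h + 1)) has_real_derivative (a - 2 * pi + x) ^ h) (at x)" for x
    by (auto intro!: derivative_eq_intros simp del: power_Suc)
  hence down: "(\<integral>\<^sup>+\<phi>. ennreal ((a - 2 * pi + \<phi>) ^ h) * indicator {2 * pi - a..2 * pi} \<phi> \<partial>lborel)
      = ennreal (a ^ (h + 1) / (h + 1))"
    using a by (subst nn_integral_FTC_Icc[where F = "\<lambda>x. (a - 2 * pi + x) ^ (h + 1) / (h + 1)"]) auto
  let ?B = "\<lambda>\<phi>. ennreal ((a - \<phi>) ^ h) * indicator {0..a} \<phi> +
           ennreal ((a - 2 * pi + \<phi>) ^ h) * indicator {2 * pi - a..2 * pi} \<phi>"
  have "(\<integral>\<^sup>+\<theta>'. ?I \<theta> \<theta>' ^ h \<partial>uniform_angle) = (\<integral>\<^sup>+\<phi>. ?I \<theta> (rotate_angle \<theta> \<phi>) ^ h \<partial>uniform_angle)"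
    by (rule nn_integral_rotate_angle[symmetric, OF \<theta>]) (use measurable_overlap[OF \<theta>] in simp)
  also have "\<dots> = (\<integral>\<^sup>+\<phi>. ?I 0 \<phi> ^ h \<partial>uniform_angle)"
    by (intro nn_integral_cong) (simp add: rot)
  also have "\<dots> \<le> (\<integral>\<^sup>+\<phi>. ennreal ((1 / (2 * pi)) ^ h) * ?B \<phi> \<partial>uniform_angle)"
    by (intro nn_integral_mono bound) simp
  also have "\<dots> = ennreal (1 / (2 * pi)) *
      (\<integral>\<^sup>+\<phi>. ennreal ((1 / (2 * pi)) ^ h) * ?B \<phi> * indicator {0..<2 * pi} \<phi> \<partial>lborel)"
    by (intro nn_integral_uniform_angle) (simp add: circle_def measurable_restrict_space1)
  also have "\<dots> \<le> ennreal (1 / (2 * pi)) * (\<integral>\<^sup>+\<phi>. ennreal ((1 / (2 * pi)) ^ h) * ?B \<phi> \<partial>lborel)"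
    by (intro mult_left_mono nn_integral_mono) (auto simp: indicator_def)
  also have "(\<integral>\<^sup>+\<phi>. ennreal ((1 / (2 * pi)) ^ h) * ?B \<phi> \<partial>lborel)
      = ennreal ((1 / (2 * pi)) ^ h) * (ennreal (a ^ (h + 1) / (h + 1)) + ennreal (a ^ (h + 1) / (h + 1)))"
    by (subst nn_integral_cmult, measurable, subst nn_integral_add, measurable) (simp only: up down)
  also have "\<dots> = ennreal ((1 / (2 * pi)) ^ h * (2 * (a ^ (h + 1) / (h + 1))))"
    using a by (subst ennreal_plus[symmetric], simp, simp, subst ennreal_mult[symmetric]) (simp_all only: mult_2, auto)
  also have "ennreal (1 / (2 * pi)) * \<dots> = ennreal (1 / (2 * pi) * ((1 / (2 * pi)) ^ h * (2 * (a ^ (h + 1) / (h + 1)))))"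
    using a by (intro ennreal_mult[symmetric]) auto
  also have "1 / (2 * pi) * ((1 / (2 * pi)) ^ h * (2 * (a ^ (h + 1) / (h + 1)))) = 2 * \<tau> ^ (h + 1) / (h + 1)"
    by (simp add: a_def power_mult_distrib field_simps)
  finally show ?thesis .
qed

section \<open>Product laws and the planted likelihood\<close>

interpretation angle: prob_space uniform_angle
  by (rule prob_space_uniform_angle)

interpretation angles: product_prob_space "\<lambda>_::nat. uniform_angle" "{..<N}" for N
  by standard

lemma prob_space_H0_law: "prob_space (H0_law N)"
  unfolding H0_law_def by (rule prob_space_PiM) (rule prob_space_uniform_angle)

lemma sets_H0_law [measurable_cong]: "sets (H0_law N) = sets (\<Pi>\<^sub>M i\<in>{..<N}. circle)"
  unfolding H0_law_def by (intro sets_PiM_cong) auto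

lemma space_H0_law: "space (H0_law N) = {..<N} \<rightarrow>\<^sub>E {0..<2 * pi}"
  by (simp add: H0_law_def space_PiM)

lemma measurable_H0_law_component [measurable]:
  "i < N \<Longrightarrow> (\<lambda>x. x i) \<in> measurable (H0_law N) circle"
  by (subst measurable_cong_sets[OF sets_H0_law refl]) (simp add: measurable_component_singleton)

lemma nn_integral_H0_law_prod:
  assumes "\<And>i. i < N \<Longrightarrow> f i \<in> borel_measurable circle"
  shows "(\<integral>\<^sup>+x. (\<Prod>i<N. f i (x i)) \<partial>H0_law N) = (\<Prod>i<N. \<integral>\<^sup>+y. f i y \<partial>uniform_angle)"
  unfolding H0_law_def
  using assms by (intro angles.product_nn_integral_prod) (auto cong: measurable_cong_sets)

lemma borel_measurable_circ_arc_weight: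
  assumes "\<theta> \<in> {0..<2 * pi}"
  shows "(\<lambda>y. if y \<in> circ_arc \<tau> \<theta> then b else c :: ennreal) \<in> borel_measurable circle"
  using circ_arc_sets[OF assms, of \<tau>] by measurable

lemma nn_integral_circ_arc_weight:
  assumes \<theta>: "\<theta> \<in> {0..<2 * pi}" and \<tau>: "0 < \<tau>" "\<tau> < 1"
  shows "(\<integral>\<^sup>+y. (if y \<in> circ_arc \<tau> \<theta> then b else c) \<partial>uniform_angle)
    = b * ennreal \<tau> + c * ennreal (1 - \<tau>)"
proof -
  let ?A = "circ_arc \<tau> \<theta>" and ?B = "space uniform_angle - circ_arc \<tau> \<theta>"
  have A: "?A \<in> sets uniform_angle" using circ_arc_sets[OF \<theta>] by simp
  have "emeasure uniform_angle ?B = ennreal (1 - \<tau>)"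
    using \<tau> by (subst emeasure_compl[OF A])
      (auto simp: emeasure_circ_arc[OF \<theta> \<tau>] angle.emeasure_space_1 simp del: space_uniform_angle
            simp flip: ennreal_minus ennreal_1)
  moreover have "(\<integral>\<^sup>+y. (if y \<in> ?A then b else c) \<partial>uniform_angle)
      = (\<integral>\<^sup>+y. b * indicator ?A y + c * indicator ?B y \<partial>uniform_angle)"
    by (intro nn_integral_cong) (auto simp: indicator_def)
  ultimately show ?thesis
    using nn_integral_cmult_indicator[OF A, of b] nn_integral_cmult_indicator[OF sets.compl_sets[OF A], of c] A
    by (simp add: nn_integral_add emeasure_circ_arc[OF \<theta> \<tau>] del: space_uniform_angle)
qed

text \<open>The density, with respect to the null law, of the sample given the planted set \<open>S\<close>
and the phase \<open>\<theta>\<close>.\<close>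

definition planted_lik :: "real \<Rightarrow> nat set \<Rightarrow> real \<Rightarrow> (nat \<Rightarrow> real) \<Rightarrow> ennreal" where
  "planted_lik \<tau> S \<theta> x = (\<Prod>i\<in>S. if x i \<in> circ_arc \<tau> \<theta> then ennreal (1 / \<tau>) else 0)"

lemma prod_extend_one:
  fixes f :: "nat \<Rightarrow> 'a :: comm_monoid_mult"
  assumes "S \<subseteq> {..<N}"
  shows "(\<Prod>i\<in>S. f i) = (\<Prod>i<N. if i \<in> S then f i else 1)"
  using assms by (intro prod.mono_neutral_cong_left) auto

lemma measurable_planted_lik [measurable (raw)]:
  assumes "S \<subseteq> {..<N}" and f [measurable]: "f \<in> measurable M circle" and g: "g \<in> measurable M (H0_law N)"
  shows "(\<lambda>z. planted_lik \<tau> S (f z) (g z)) \<in> borel_measurable M"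
  unfolding planted_lik_def
proof (rule borel_measurable_prod_ennreal)
  fix i assume "i \<in> S"
  hence [measurable]: "(\<lambda>z. g z i) \<in> measurable M circle"
    using assms by (intro measurable_compose[OF g] measurable_H0_law_component) auto
  show "(\<lambda>z. if g z i \<in> circ_arc \<tau> (f z) then ennreal (1 / \<tau>) else 0) \<in> borel_measurable M"
    by measurable
qed

text \<open>Every factor \<open>uniform_measure circle (circ_arc \<tau> \<theta>)\<close> is
\<open>uniform_angle\<close> with density \<open>1 / \<tau>\<close> on the arc, so it suffices to
compare both sides on boxes, where the integral of the product factorizes.\<close>

lemma PiM_planted_eq_density:
  assumes \<theta>: "\<theta> \<in> {0..<2 * pi}" and \<tau>: "0 < \<tau>" "\<tau> < 1" and S: "S \<subseteq> {..<N}"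
  shows "(\<Pi>\<^sub>M i\<in>{..<N}. if i \<in> S then uniform_measure circle (circ_arc \<tau> \<theta>) else uniform_angle)
    = density (H0_law N) (planted_lik \<tau> S \<theta>)"
proof -
  let ?M = "\<lambda>i. if i \<in> S then uniform_measure circle (circ_arc \<tau> \<theta>) else uniform_angle"
  let ?f = "\<lambda>i y. if i \<in> S then if y \<in> circ_arc \<tau> \<theta> then ennreal (1 / \<tau>) else 0 else 1"
  note arc [measurable] = circ_arc_sets[OF \<theta>, of \<tau>]
  have sets_M [simp]: "sets (?M i) = sets circle" for i by simp
  have em: "emeasure circle (circ_arc \<tau> \<theta>) = ennreal (2 * pi * \<tau>)"
  proof -
    have "ennreal (2 * pi) * (ennreal (1 / (2 * pi)) * emeasure circle (circ_arc \<tau> \<theta>))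
        = ennreal (2 * pi) * ennreal \<tau>"
      using emeasure_circ_arc[OF \<theta> \<tau>] by (simp only: emeasure_uniform_angle[OF arc] emeasure_circle[OF arc])
    also have "\<dots> = ennreal (2 * pi * \<tau>)"
      using \<tau> by (intro ennreal_mult[symmetric]) auto
    finally have "(ennreal (2 * pi) * ennreal (1 / (2 * pi))) * emeasure circle (circ_arc \<tau> \<theta>)
        = ennreal (2 * pi * \<tau>)"
      by (simp only: mult.assoc)
    thus ?thesis by (simp flip: ennreal_mult)
  qed
  have pM: "prob_space (?M i)" for i
    using \<tau> em prob_space_uniform_angle by (auto intro!: prob_space_uniform_measure)
  interpret M: product_sigma_finite ?M
    by (rule product_sigma_finite.intro) (rule prob_space_imp_sigma_finite[OF pM])
  have f [measurable]: "?f i \<in> borel_measurable circle" for i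
    by (cases "i \<in> S") (auto simp: borel_measurable_circ_arc_weight[OF \<theta>])
  have marg: "(\<integral>\<^sup>+y. ?f i y * indicator B y \<partial>uniform_angle) = emeasure (?M i) B" if B: "B \<in> sets circle" for i B
  proof (cases "i \<in> S")
    case True
    have "(\<integral>\<^sup>+y. ?f i y * indicator B y \<partial>uniform_angle)
        = (\<integral>\<^sup>+y. ennreal (1 / \<tau>) * indicator (circ_arc \<tau> \<theta> \<inter> B) y \<partial>uniform_angle)"
      using True by (intro nn_integral_cong) (auto simp: indicator_def)
    also have "\<dots> = ennreal (1 / \<tau>) * emeasure uniform_angle (circ_arc \<tau> \<theta> \<inter> B)"
      using B by (intro nn_integral_cmult_indicator) simp
    also have "\<dots> = emeasure circle (circ_arc \<tau> \<theta> \<inter> B) * (ennreal (1 / \<tau>) * ennreal (1 / (2 * pi)))"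
      using B by (simp only: emeasure_uniform_angle[OF sets.Int[OF arc B]]
          emeasure_circle[OF sets.Int[OF arc B]] mult_ac)
    also have "ennreal (1 / \<tau>) * ennreal (1 / (2 * pi)) = inverse (ennreal (2 * pi * \<tau>))"
      using \<tau> by (simp add: inverse_ennreal inverse_eq_divide ennreal_mult[symmetric] mult.commute)
    finally show ?thesis using True B em by (simp add: divide_ennreal_def)
  qed (use B in simp)
  have "density (H0_law N) (planted_lik \<tau> S \<theta>) = PiM {..<N} ?M"
  proof (rule M.PiM_eqI)
    show "sets (density (H0_law N) (planted_lik \<tau> S \<theta>)) = sets (PiM {..<N} ?M)"
      by (simp add: sets_H0_law del: sets_uniform_measure) (intro sets_PiM_cong, auto)
    fix A assume "\<And>i. i \<in> {..<N} \<Longrightarrow> A i \<in> sets (?M i)"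
    hence A: "A i \<in> sets circle" if "i < N" for i using that sets_M by blast
    have PA: "Pi\<^sub>E {..<N} A \<in> sets (H0_law N)"
      unfolding sets_H0_law using A by (intro sets_PiM_I_finite) auto
    have [measurable]: "planted_lik \<tau> S \<theta> \<in> borel_measurable (H0_law N)"
      using measurable_planted_lik[OF S, of "\<lambda>_. \<theta>" "H0_law N" "\<lambda>x. x" \<tau>] \<theta> by simp
    have "emeasure (density (H0_law N) (planted_lik \<tau> S \<theta>)) (Pi\<^sub>E {..<N} A)
        = (\<integral>\<^sup>+x. planted_lik \<tau> S \<theta> x * indicator (Pi\<^sub>E {..<N} A) x \<partial>H0_law N)"
      using PA by (simp add: emeasure_density)
    also have "\<dots> = (\<integral>\<^sup>+x. (\<Prod>i<N. ?f i (x i) * indicator (A i) (x i)) \<partial>H0_law N)"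
    proof (intro nn_integral_cong)
      fix x assume "x \<in> space (H0_law N)"
      hence "indicator (Pi\<^sub>E {..<N} A) x = (\<Prod>i<N. indicator (A i) (x i) :: ennreal)"
        by (auto simp: space_H0_law indicator_def PiE_iff prod_zero_iff)
      thus "planted_lik \<tau> S \<theta> x * indicator (Pi\<^sub>E {..<N} A) x
          = (\<Prod>i<N. ?f i (x i) * indicator (A i) (x i))"
        unfolding planted_lik_def prod_extend_one[OF S] prod.distrib by simp
    qed
    also have "\<dots> = (\<Prod>i<N. \<integral>\<^sup>+y. ?f i y * indicator (A i) y \<partial>uniform_angle)"
      using A by (intro nn_integral_H0_law_prod borel_measurable_times_ennreal f
          borel_measurable_indicator) auto
    also have "\<dots> = (\<Prod>i<N. emeasure (?M i) (A i))"
      using A by (intro prod.cong refl marg) auto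
    finally show "emeasure (density (H0_law N) (planted_lik \<tau> S \<theta>)) (Pi\<^sub>E {..<N} A) = \<dots>" .
  qed simp
  thus ?thesis by simp
qed

text \<open>An exponential moment, with \<open>b\<close> in the role of the exponentiated parameter, of the
number of unplanted points that fall into the planted arc.\<close>

lemma nn_integral_planted_weight:
  assumes \<theta>: "\<theta> \<in> {0..<2 * pi}" and \<tau>: "0 < \<tau>" "\<tau> < 1" and S: "S \<subseteq> {..<N}"
  shows "(\<integral>\<^sup>+x. planted_lik \<tau> S \<theta> x * (\<Prod>i\<in>{..<N} - S. if x i \<in> circ_arc \<tau> \<theta> then b else 1) \<partial>H0_law N)
     = (b * ennreal \<tau> + ennreal (1 - \<tau>)) ^ (N - card S)"
proof -
  let ?f = "\<lambda>i y. if i \<in> S then if y \<in> circ_arc \<tau> \<theta> then ennreal (1 / \<tau>) else 0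
             else if y \<in> circ_arc \<tau> \<theta> then b else 1"
  have "planted_lik \<tau> S \<theta> x * (\<Prod>i\<in>{..<N} - S. if x i \<in> circ_arc \<tau> \<theta> then b else 1)
      = (\<Prod>i<N. ?f i (x i))" for x
  proof -
    have "{..<N} = S \<union> ({..<N} - S)" using S by auto
    hence "(\<Prod>i<N. ?f i (x i)) = (\<Prod>i\<in>S \<union> ({..<N} - S). ?f i (x i))" by metis
    also have "\<dots> = (\<Prod>i\<in>S. ?f i (x i)) * (\<Prod>i\<in>{..<N} - S. ?f i (x i))"
      using S by (intro prod.union_disjoint) (auto intro: finite_subset)
    finally show ?thesis by (simp add: planted_lik_def)
  qed
  hence "(\<integral>\<^sup>+x. planted_lik \<tau> S \<theta> x * (\<Prod>i\<in>{..<N} - S. if x i \<in> circ_arc \<tau> \<theta> then b else 1) \<partial>H0_law N)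
      = (\<integral>\<^sup>+x. (\<Prod>i<N. ?f i (x i)) \<partial>H0_law N)" by (simp only:)
  also have "\<dots> = (\<Prod>i<N. \<integral>\<^sup>+y. ?f i y \<partial>uniform_angle)"
  proof (rule nn_integral_H0_law_prod)
    fix i show "?f i \<in> borel_measurable circle"
      by (cases "i \<in> S") (auto simp: borel_measurable_circ_arc_weight[OF \<theta>])
  qed
  also have "\<dots> = (\<Prod>i<N. if i \<in> {..<N} - S then b * ennreal \<tau> + ennreal (1 - \<tau>) else 1)"
    using \<tau> by (intro prod.cong refl)
      (auto simp: nn_integral_circ_arc_weight[OF \<theta> \<tau>] simp flip: ennreal_mult)
  also have "\<dots> = (\<Prod>i\<in>{..<N} - S. b * ennreal \<tau> + ennreal (1 - \<tau>))"
    by (subst prod_extend_one[of "{..<N} - S" N]) auto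
  also have "\<dots> = (b * ennreal \<tau> + ennreal (1 - \<tau>)) ^ (N - card S)"
    using S by (simp add: card_Diff_subset finite_subset[OF S])
  finally show ?thesis .
qed

text \<open>A coordinate in \<open>S \<inter> S'\<close> has to lie in both arcs; a coordinate in only one of
the sets integrates its normalized density to \<open>1\<close>.\<close>

lemma nn_integral_planted_lik_mult:
  assumes \<theta>: "\<theta> \<in> {0..<2 * pi}" "\<theta>' \<in> {0..<2 * pi}" and \<tau>: "0 < \<tau>" "\<tau> < 1"
    and S: "S \<subseteq> {..<N}" "S' \<subseteq> {..<N}"
  shows "(\<integral>\<^sup>+x. planted_lik \<tau> S \<theta> x * planted_lik \<tau> S' \<theta>' x \<partial>H0_law N)
     = (ennreal (1 / \<tau>\<^sup>2) * emeasure uniform_angle (circ_arc \<tau> \<theta> \<inter> circ_arc \<tau> \<theta>')) ^ card (S \<inter> S')"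
proof -
  let ?f = "\<lambda>i y. (if i \<in> S then if y \<in> circ_arc \<tau> \<theta> then ennreal (1 / \<tau>) else 0 else 1) *
              (if i \<in> S' then if y \<in> circ_arc \<tau> \<theta>' then ennreal (1 / \<tau>) else 0 else 1)"
  let ?r = "ennreal (1 / \<tau>\<^sup>2) * emeasure uniform_angle (circ_arc \<tau> \<theta> \<inter> circ_arc \<tau> \<theta>')"
  note arc [measurable] = circ_arc_sets[OF \<theta>(1), of \<tau>] circ_arc_sets[OF \<theta>(2), of \<tau>]
  note w = borel_measurable_circ_arc_weight[OF \<theta>(1)] borel_measurable_circ_arc_weight[OF \<theta>(2)]
  have "planted_lik \<tau> S \<theta> x * planted_lik \<tau> S' \<theta>' x = (\<Prod>i<N. ?f i (x i))" for x
    unfolding planted_lik_def prod_extend_one[OF S(1)] prod_extend_one[OF S(2)] prod.distrib ..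
  hence "(\<integral>\<^sup>+x. planted_lik \<tau> S \<theta> x * planted_lik \<tau> S' \<theta>' x \<partial>H0_law N)
      = (\<integral>\<^sup>+x. (\<Prod>i<N. ?f i (x i)) \<partial>H0_law N)" by (simp only:)
  also have "\<dots> = (\<Prod>i<N. \<integral>\<^sup>+y. ?f i y \<partial>uniform_angle)"
  proof (rule nn_integral_H0_law_prod)
    fix i show "?f i \<in> borel_measurable circle"
      by (cases "i \<in> S"; cases "i \<in> S'") (auto intro!: borel_measurable_times_ennreal w)
  qed
  also have "\<dots> = (\<Prod>i<N. if i \<in> S \<inter> S' then ?r else 1)"
  proof (intro prod.cong refl)
    fix i
    have both: "(\<integral>\<^sup>+y. (if y \<in> circ_arc \<tau> \<theta> then ennreal (1 / \<tau>) else 0) *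
          (if y \<in> circ_arc \<tau> \<theta>' then ennreal (1 / \<tau>) else 0) \<partial>uniform_angle) = ?r"
    proof -
      have "(\<integral>\<^sup>+y. (if y \<in> circ_arc \<tau> \<theta> then ennreal (1 / \<tau>) else 0) *
          (if y \<in> circ_arc \<tau> \<theta>' then ennreal (1 / \<tau>) else 0) \<partial>uniform_angle)
        = (\<integral>\<^sup>+y. ennreal (1 / \<tau>\<^sup>2) * indicator (circ_arc \<tau> \<theta> \<inter> circ_arc \<tau> \<theta>') y \<partial>uniform_angle)"
        using \<tau> by (intro nn_integral_cong)
          (auto simp: indicator_def power2_eq_square simp flip: ennreal_mult)
      thus ?thesis by (simp add: nn_integral_cmult_indicator)
    qed
    show "(\<integral>\<^sup>+y. ?f i y \<partial>uniform_angle) = (if i \<in> S \<inter> S' then ?r else 1)"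
      using \<tau> by (cases "i \<in> S"; cases "i \<in> S'")
        (auto simp: both nn_integral_circ_arc_weight[OF \<theta>(1) \<tau>] nn_integral_circ_arc_weight[OF \<theta>(2) \<tau>]
             angle.emeasure_space_1 simp del: space_uniform_angle simp flip: ennreal_mult)
  qed
  also have "\<dots> = (\<Prod>i\<in>S \<inter> S'. ?r)"
    using S by (subst prod_extend_one[of "S \<inter> S'" N]) auto
  finally show ?thesis by simp
qed

text \<open>Conditionally on \<open>x j\<close> the other coordinates are independent, and each is in the arc
that starts at \<open>x j\<close> with probability \<open>\<tau>\<close> whatever the value of
\<open>x j\<close>. The weights \<open>b\<close>, \<open>c\<close> are free so that both
indicators of subsets and exponential moments are covered.\<close>

lemma nn_integral_H0_law_neighbours:
  fixes b c :: "nat \<Rightarrow> ennreal"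
  assumes \<tau>: "0 < \<tau>" "\<tau> < 1" and j: "j < N"
  shows "(\<integral>\<^sup>+x. (\<Prod>i\<in>{..<N} - {j}. if x i \<in> circ_arc \<tau> (x j) then b i else c i) \<partial>H0_law N)
     = (\<Prod>i\<in>{..<N} - {j}. b i * ennreal \<tau> + c i * ennreal (1 - \<tau>))"
proof -
  let ?J = "{..<N} - {j}"
  let ?F = "\<lambda>x. \<Prod>i\<in>?J. if x i \<in> circ_arc \<tau> (x j) then b i else c i"
  have ins: "insert j ?J = {..<N}" using j by auto
  have F: "?F \<in> borel_measurable (H0_law N)"
    using j by (intro borel_measurable_prod_ennreal) measurable
  have "integral\<^sup>N (H0_law N) ?F
      = (\<integral>\<^sup>+y. (\<integral>\<^sup>+x. ?F (x(j := y)) \<partial>PiM ?J (\<lambda>_. uniform_angle)) \<partial>uniform_angle)"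
    using F angles.product_nn_integral_insert_rev[of ?J j ?F] unfolding H0_law_def ins by simp
  also have "\<dots> = (\<integral>\<^sup>+y. (\<Prod>i\<in>?J. b i * ennreal \<tau> + c i * ennreal (1 - \<tau>)) \<partial>uniform_angle)"
  proof (intro nn_integral_cong)
    fix y assume "y \<in> space uniform_angle"
    hence y: "y \<in> {0..<2 * pi}" by simp
    have "(\<integral>\<^sup>+x. ?F (x(j := y)) \<partial>PiM ?J (\<lambda>_. uniform_angle))
        = (\<integral>\<^sup>+x. (\<Prod>i\<in>?J. if x i \<in> circ_arc \<tau> y then b i else c i) \<partial>PiM ?J (\<lambda>_. uniform_angle))"
      by (intro nn_integral_cong prod.cong) auto
    also have "\<dots> = (\<Prod>i\<in>?J. \<integral>\<^sup>+z. (if z \<in> circ_arc \<tau> y then b i else c i) \<partial>uniform_angle)"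
      using borel_measurable_circ_arc_weight[OF y, of \<tau>]
      by (intro angles.product_nn_integral_prod[where f = "\<lambda>i z. if z \<in> circ_arc \<tau> y then b i else c i"])
         (auto cong: measurable_cong_sets)
    finally show "(\<integral>\<^sup>+x. ?F (x(j := y)) \<partial>PiM ?J (\<lambda>_. uniform_angle))
        = (\<Prod>i\<in>?J. b i * ennreal \<tau> + c i * ennreal (1 - \<tau>))"
      by (simp add: nn_integral_circ_arc_weight[OF y \<tau>])
  qed
  also have "\<dots> = (\<Prod>i\<in>?J. b i * ennreal \<tau> + c i * ennreal (1 - \<tau>))"
    by (simp add: angle.emeasure_space_1 del: space_uniform_angle)
  finally show ?thesis .
qed

section \<open>The alternative as a mixture\<close>

interpretation H0: prob_space "H0_law N" for N
  by (rule prob_space_H0_law)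

text \<open>The mixture over the phase is a monadic bind, which is meaningful only for a measurable kernel.
Measurability comes from the joint measurability of the density.\<close>

lemma planted_kernel_measurable:
  assumes \<tau>: "0 < \<tau>" "\<tau> < 1"
  shows "(\<lambda>\<theta>. \<Pi>\<^sub>M i\<in>{..<N}. if i \<in> S then uniform_measure circle (circ_arc \<tau> \<theta>) else uniform_angle)
     \<in> measurable uniform_angle (subprob_algebra (H0_law N))"
    and emeasure_planted_kernel:
      "\<And>\<theta> A. \<theta> \<in> {0..<2 * pi} \<Longrightarrow> A \<in> sets (H0_law N) \<Longrightarrow> S \<subseteq> {..<N} \<Longrightarrow>
        emeasure (\<Pi>\<^sub>M i\<in>{..<N}. if i \<in> S then uniform_measure circle (circ_arc \<tau> \<theta>) else uniform_angle) A
        = (\<integral>\<^sup>+x. planted_lik \<tau> S \<theta> x * indicator A x \<partial>H0_law N)"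
proof -
  let ?P = "\<lambda>S \<theta>. \<Pi>\<^sub>M i\<in>{..<N}. if i \<in> S then uniform_measure circle (circ_arc \<tau> \<theta>) else uniform_angle"
  have em: "emeasure (?P S \<theta>) A = (\<integral>\<^sup>+x. planted_lik \<tau> S \<theta> x * indicator A x \<partial>H0_law N)"
    if \<theta>: "\<theta> \<in> {0..<2 * pi}" and A: "A \<in> sets (H0_law N)" and S: "S \<subseteq> {..<N}" for S \<theta> A
    unfolding PiM_planted_eq_density[OF \<theta> \<tau> S]
    using A \<theta> measurable_planted_lik[OF S, of "\<lambda>_. \<theta>" "H0_law N" "\<lambda>x. x" \<tau>]
    by (intro emeasure_density) auto
  show "\<And>\<theta> A. \<theta> \<in> {0..<2 * pi} \<Longrightarrow> A \<in> sets (H0_law N) \<Longrightarrow> S \<subseteq> {..<N} \<Longrightarrow>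
        emeasure (?P S \<theta>) A = (\<integral>\<^sup>+x. planted_lik \<tau> S \<theta> x * indicator A x \<partial>H0_law N)"
    by (rule em)
  \<comment> \<open>The outer bind ranges over all sets of indices; only the members below \<open>N\<close> enter the product.\<close>
  define T where "T = S \<inter> {..<N}"
  have T: "T \<subseteq> {..<N}" by (simp add: T_def)
  have eq: "?P S \<theta> = ?P T \<theta>" for \<theta>
    by (intro PiM_cong) (auto simp: T_def)
  have "?P T \<in> measurable uniform_angle (subprob_algebra (H0_law N))"
  proof (rule measurable_subprob_algebra)
    fix \<theta> assume "\<theta> \<in> space uniform_angle"
    hence \<theta>: "\<theta> \<in> {0..<2 * pi}" by simp
    have p: "emeasure uniform_angle (circ_arc \<tau> \<theta>) = ennreal \<tau>"
      by (rule emeasure_circ_arc[OF \<theta> \<tau>])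
    have "emeasure circle (circ_arc \<tau> \<theta>) \<noteq> 0"
      using p \<tau> by (auto simp: emeasure_uniform_angle emeasure_circle circ_arc_sets[OF \<theta>])
    moreover have "emeasure circle (circ_arc \<tau> \<theta>) \<noteq> \<infinity>"
    proof -
      have "emeasure circle (circ_arc \<tau> \<theta>) \<le> emeasure circle {0..<2 * pi}"
        using emeasure_space[of circle "circ_arc \<tau> \<theta>"] by simp
      also have "\<dots> < \<infinity>" by (simp add: emeasure_circle_space)
      finally show ?thesis by simp
    qed
    ultimately have "prob_space (?P T \<theta>)"
      by (intro prob_space_PiM) (auto intro: prob_space_uniform_measure prob_space_uniform_angle)
    thus "subprob_space (?P T \<theta>)" by (rule prob_space_imp_subprob_space)
    show "sets (?P T \<theta>) = sets (H0_law N)"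
      by (simp add: PiM_planted_eq_density[OF \<theta> \<tau> T])
  next
    fix A assume A [measurable]: "A \<in> sets (H0_law N)"
    have [measurable]: "(\<lambda>p. planted_lik \<tau> T (fst p) (snd p)) \<in> borel_measurable (uniform_angle \<Otimes>\<^sub>M H0_law N)"
      by (rule measurable_planted_lik[OF T]) (auto cong: measurable_cong_sets)
    have "(\<lambda>\<theta>. \<integral>\<^sup>+x. planted_lik \<tau> T \<theta> x * indicator A x \<partial>H0_law N) \<in> borel_measurable uniform_angle"
      by (rule H0.borel_measurable_nn_integral) (simp add: split_beta)
    thus "(\<lambda>\<theta>. emeasure (?P T \<theta>) A) \<in> borel_measurable uniform_angle"
      using A T by (subst measurable_cong[OF em]) auto
  qed
  thus "?P S \<in> measurable uniform_angle (subprob_algebra (H0_law N))"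
    by (simp only: eq)
qed

text \<open>Each of the \<open>N choose K\<close> planted sets has the same probability, so the outer bind is an average.\<close>

lemma
  assumes \<tau>: "0 < \<tau>" "\<tau> < 1" and K: "K \<le> N"
  shows sets_H1_law: "sets (H1_law N K \<tau>) = sets (H0_law N)"
    and emeasure_H1_law: "\<And>A. A \<in> sets (H0_law N) \<Longrightarrow> emeasure (H1_law N K \<tau>) A =
      (\<Sum>S | S \<subseteq> {..<N} \<and> card S = K. \<integral>\<^sup>+\<theta>. (\<integral>\<^sup>+x. planted_lik \<tau> S \<theta> x * indicator A x \<partial>H0_law N) \<partial>uniform_angle)
      / of_nat (N choose K)"
proof -
  let ?F = "{S. S \<subseteq> {..<N} \<and> card S = K}"
  have card: "card ?F = N choose K" using n_subsets[of "{..<N}" K] by simp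
  have fin: "finite ?F" by (rule finite_subset[of _ "Pow {..<N}"]) auto
  have "card ?F > 0" unfolding card using K by simp
  hence ne: "?F \<noteq> {}" by (metis card.empty less_irrefl)
  let ?k = "\<lambda>S \<theta>. \<Pi>\<^sub>M i\<in>{..<N}. if i \<in> S then uniform_measure circle (circ_arc \<tau> \<theta>) else uniform_angle"
  have k: "?k S \<in> measurable uniform_angle (subprob_algebra (H0_law N))" for S
    by (rule planted_kernel_measurable[OF \<tau>])
  have m: "(\<lambda>S. bind uniform_angle (?k S)) \<in> measurable (measure_pmf (pmf_of_set ?F)) (subprob_algebra (H0_law N))"
    using angle.bind_in_space[OF k] by simp
  show "sets (H1_law N K \<tau>) = sets (H0_law N)"
    unfolding H1_law_def by (rule sets_bind_measurable[OF m]) simp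
  fix A assume A: "A \<in> sets (H0_law N)"
  have "emeasure (H1_law N K \<tau>) A = (\<integral>\<^sup>+S. emeasure (bind uniform_angle (?k S)) A \<partial>measure_pmf (pmf_of_set ?F))"
    unfolding H1_law_def by (rule emeasure_bind[OF _ m A]) simp
  also have "\<dots> = (\<Sum>S\<in>?F. emeasure (bind uniform_angle (?k S)) A) / of_nat (N choose K)"
    using nn_integral_pmf_of_set[OF ne fin] by (simp add: card ennreal_of_nat_eq_real_of_nat)
  also have "(\<Sum>S\<in>?F. emeasure (bind uniform_angle (?k S)) A)
      = (\<Sum>S\<in>?F. \<integral>\<^sup>+\<theta>. (\<integral>\<^sup>+x. planted_lik \<tau> S \<theta> x * indicator A x \<partial>H0_law N) \<partial>uniform_angle)"
  proof (intro sum.cong refl)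
    fix S assume "S \<in> ?F"
    hence S: "S \<subseteq> {..<N}" by simp
    have "emeasure (bind uniform_angle (?k S)) A = (\<integral>\<^sup>+\<theta>. emeasure (?k S \<theta>) A \<partial>uniform_angle)"
      by (rule emeasure_bind[OF _ k A]) simp
    also have "\<dots> = (\<integral>\<^sup>+\<theta>. (\<integral>\<^sup>+x. planted_lik \<tau> S \<theta> x * indicator A x \<partial>H0_law N) \<partial>uniform_angle)"
      by (intro nn_integral_cong emeasure_planted_kernel[OF \<tau>]) (use A S in auto)
    finally show "emeasure (bind uniform_angle (?k S)) A = \<dots>" .
  qed
  finally show "emeasure (H1_law N K \<tau>) A =
      (\<Sum>S\<in>?F. \<integral>\<^sup>+\<theta>. (\<integral>\<^sup>+x. planted_lik \<tau> S \<theta> x * indicator A x \<partial>H0_law N) \<partial>uniform_angle)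
      / of_nat (N choose K)" .
qed

lemma emeasure_H1_law_le:
  assumes \<tau>: "0 < \<tau>" "\<tau> < 1" and K: "K \<le> N" and A: "A \<in> sets (H0_law N)"
    and le: "\<And>S \<theta>. S \<subseteq> {..<N} \<Longrightarrow> card S = K \<Longrightarrow> \<theta> \<in> {0..<2 * pi} \<Longrightarrow>
      (\<integral>\<^sup>+x. planted_lik \<tau> S \<theta> x * indicator A x \<partial>H0_law N) \<le> \<epsilon>"
  shows "emeasure (H1_law N K \<tau>) A \<le> \<epsilon>"
proof -
  let ?F = "{S. S \<subseteq> {..<N} \<and> card S = K}"
  have card: "card ?F = N choose K" using n_subsets[of "{..<N}" K] by simp
  have "emeasure (H1_law N K \<tau>) A \<le> (\<Sum>S\<in>?F. \<epsilon>) / of_nat (N choose K)"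
    unfolding emeasure_H1_law[OF \<tau> K A]
  proof (intro divide_right_mono_ennreal sum_mono)
    fix S assume "S \<in> ?F"
    hence "(\<integral>\<^sup>+\<theta>. (\<integral>\<^sup>+x. planted_lik \<tau> S \<theta> x * indicator A x \<partial>H0_law N) \<partial>uniform_angle)
        \<le> (\<integral>\<^sup>+\<theta>. \<epsilon> \<partial>uniform_angle)"
      by (intro nn_integral_mono le) auto
    thus "(\<integral>\<^sup>+\<theta>. (\<integral>\<^sup>+x. planted_lik \<tau> S \<theta> x * indicator A x \<partial>H0_law N) \<partial>uniform_angle) \<le> \<epsilon>"
      by (simp add: angle.emeasure_space_1 del: space_uniform_angle)
  qed
  also have "\<dots> = \<epsilon> * (of_nat (N choose K) / of_nat (N choose K))"
    by (simp add: card ennreal_times_divide mult.commute)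
  also have "of_nat (N choose K) / of_nat (N choose K) = (1 :: ennreal)"
    using K by (intro ennreal_divide_self) (auto simp: ennreal_of_nat_eq_real_of_nat)
  finally show ?thesis by simp
qed

section \<open>The interval test as a finite maximum\<close>

lemma sum_indicat_eq_card:
  fixes x :: "nat \<Rightarrow> real"
  shows "(\<Sum>i<N. indicat_real A (x i)) = real (card {i \<in> {..<N}. x i \<in> A})"
  by (simp add: indicator_def Int_def)

text \<open>Lift the points of the window to the real line, into \<open>[\<theta>, \<theta> +
2\<pi>\<tau>]\<close>, and let \<open>j\<close> be the one that comes first: moving the left end
of the window from \<open>\<theta>\<close> up to it drops no other point.\<close>

lemma window_anchored_at_point:
  fixes x :: "nat \<Rightarrow> real"
  assumes x: "\<And>i. i < N \<Longrightarrow> x i \<in> {0..<2 * pi}" and ne: "{i \<in> {..<N}. x i \<in> circ_arc \<tau> \<theta>} \<noteq> {}"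
  obtains j where "j < N"
    "{i \<in> {..<N}. x i \<in> circ_arc \<tau> \<theta>} \<subseteq> {i \<in> {..<N}. x i \<in> circ_arc \<tau> (x j)}"
proof -
  let ?I = "{i \<in> {..<N}. x i \<in> circ_arc \<tau> \<theta>}"
  have "\<exists>k::int. x i + 2 * pi * of_int k \<in> {\<theta>..\<theta> + 2 * pi * \<tau>}" if "i \<in> ?I" for i
    using that unfolding circ_arc_def by blast
  then obtain k :: "nat \<Rightarrow> int" where
    k: "\<And>i. i \<in> ?I \<Longrightarrow> x i + 2 * pi * of_int (k i) \<in> {\<theta>..\<theta> + 2 * pi * \<tau>}"
    by metis
  define d where "d i = x i + 2 * pi * of_int (k i)" for i
  obtain j where j: "j \<in> ?I" "\<And>i. i \<in> ?I \<Longrightarrow> d j \<le> d i"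
  proof -
    have fin: "finite ?I" by simp
    have "arg_min_on d ?I \<in> ?I" "\<not> (\<exists>i\<in>?I. d i < d (arg_min_on d ?I))"
      using arg_min_if_finite[OF fin ne, of d] by blast+
    thus ?thesis using that[of "arg_min_on d ?I"] by (meson not_less)
  qed
  have "x i \<in> circ_arc \<tau> (x j)" if i: "i \<in> ?I" for i
  proof -
    have "x i + 2 * pi * of_int (k i - k j) \<in> {x j..x j + 2 * pi * \<tau>}"
      using j(2)[OF i] k[OF i] k[OF j(1)] by (auto simp: d_def algebra_simps)
    thus ?thesis using i x unfolding circ_arc_def by blast
  qed
  thus thesis using that[of j] j(1) by blast
qed

text \<open>The supremum over a continuum of windows becomes a finite disjunction. This gives both
measurability of the test and the union bound.\<close>

lemma interval_test_iff:
  assumes x: "\<And>i. i < N \<Longrightarrow> x i \<in> {0..<2 * pi}"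
  shows "interval_test N \<tau> \<gamma> x \<longleftrightarrow>
    \<gamma> \<le> 0 \<or> (\<exists>j<N. \<gamma> \<le> real (card {i \<in> {..<N}. x i \<in> circ_arc \<tau> (x j)}))"
proof -
  let ?c = "\<lambda>\<theta>. card {i \<in> {..<N}. x i \<in> circ_arc \<tau> \<theta>}"
  let ?V = "(\<lambda>\<theta>. real (?c \<theta>)) ` {0..<2 * pi}"
  have bound: "?c \<theta> \<le> N" for \<theta>
    using card_mono[of "{..<N}" "{i \<in> {..<N}. x i \<in> circ_arc \<tau> \<theta>}"] by auto
  have fin: "finite ?V"
    by (rule finite_subset[of _ "real ` {..N}"]) (use bound in auto)
  have V0: "real (?c 0) \<in> ?V" by (intro imageI) simp
  have "interval_test N \<tau> \<gamma> x \<longleftrightarrow> \<gamma> \<le> Max ?V"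
    unfolding interval_test_def sum_indicat_eq_card using fin V0 by (subst cSup_eq_Max) auto
  also have "\<dots> \<longleftrightarrow> (\<exists>\<theta>\<in>{0..<2 * pi}. \<gamma> \<le> real (?c \<theta>))"
    using fin V0 by (subst Max_ge_iff) auto
  also have "\<dots> \<longleftrightarrow> \<gamma> \<le> 0 \<or> (\<exists>j<N. \<gamma> \<le> real (?c (x j)))"
  proof
    assume "\<exists>\<theta>\<in>{0..<2 * pi}. \<gamma> \<le> real (?c \<theta>)"
    then obtain \<theta> where \<theta>: "\<gamma> \<le> real (?c \<theta>)" by blast
    show "\<gamma> \<le> 0 \<or> (\<exists>j<N. \<gamma> \<le> real (?c (x j)))"
    proof (cases "{i \<in> {..<N}. x i \<in> circ_arc \<tau> \<theta>} = {}")
      case True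
      have "?c \<theta> = 0" unfolding True by (rule card.empty)
      hence "\<gamma> \<le> 0" using \<theta> by linarith
      thus ?thesis ..
    next
      case False
      then obtain j where j: "j < N"
        "{i \<in> {..<N}. x i \<in> circ_arc \<tau> \<theta>} \<subseteq> {i \<in> {..<N}. x i \<in> circ_arc \<tau> (x j)}"
        using window_anchored_at_point[of N x \<tau> \<theta>] x by blast
      hence "?c \<theta> \<le> ?c (x j)" by (intro card_mono) auto
      thus ?thesis using \<theta> j(1) by force
    qed
  next
    assume "\<gamma> \<le> 0 \<or> (\<exists>j<N. \<gamma> \<le> real (?c (x j)))"
    thus "\<exists>\<theta>\<in>{0..<2 * pi}. \<gamma> \<le> real (?c \<theta>)"
    proof
      assume "\<gamma> \<le> 0"
      hence "\<gamma> \<le> real (?c 0)" by linarith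
      thus ?thesis by (intro bexI[of _ 0]) auto
    next
      assume "\<exists>j<N. \<gamma> \<le> real (?c (x j))"
      thus ?thesis using x by blast
    qed
  qed
  finally show ?thesis .
qed

lemma measurable_card_neighbours:
  assumes "j < N" "J \<subseteq> {..<N}"
  shows "(\<lambda>x. real (card {i \<in> J. x i \<in> circ_arc \<tau> (x j)})) \<in> borel_measurable (H0_law N)"
proof -
  have fin: "finite J" using assms finite_subset by blast
  have "real (card {i \<in> J. x i \<in> circ_arc \<tau> (x j)}) = (\<Sum>i\<in>J. if x i \<in> circ_arc \<tau> (x j) then 1 else 0)" for x
    using fin by (simp add: sum.If_cases Int_def)
  moreover have "(\<lambda>x. \<Sum>i\<in>J. if x i \<in> circ_arc \<tau> (x j) then 1 else 0 :: real) \<in> borel_measurable (H0_law N)"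
  proof (rule borel_measurable_sum)
    fix i assume "i \<in> J"
    hence "i < N" using assms by auto
    note [measurable] = measurable_H0_law_component[OF this] measurable_H0_law_component[OF assms(1)]
    show "(\<lambda>x. if x i \<in> circ_arc \<tau> (x j) then 1 else 0 :: real) \<in> borel_measurable (H0_law N)"
      by measurable
  qed
  ultimately show ?thesis by simp
qed

lemma is_test_iff: "is_test N \<phi> \<longleftrightarrow> Measurable.pred (H0_law N) \<phi>"
  unfolding is_test_def by (intro arg_cong2[where f = "(\<in>)"] measurable_cong_sets refl) (simp add: sets_H0_law)

lemma is_test_interval_test: "is_test N (interval_test N \<tau> \<gamma>)"
proof -
  let ?Q = "\<lambda>x j. \<gamma> \<le> real (card {i \<in> {..<N}. x i \<in> circ_arc \<tau> (x j)})"
  have "Measurable.pred (H0_law N) (\<lambda>x. ?Q x j)" if "j < N" for j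
  proof -
    have [measurable]: "(\<lambda>x. real (card {i \<in> {..<N}. x i \<in> circ_arc \<tau> (x j)})) \<in> borel_measurable (H0_law N)"
      using that by (intro measurable_card_neighbours) auto
    show ?thesis by measurable
  qed
  hence "Measurable.pred (H0_law N) (\<lambda>x. \<exists>j\<in>{..<N}. ?Q x j)"
    by (intro pred_intros_finite) auto
  hence meas: "Measurable.pred (H0_law N) (\<lambda>x. \<gamma> \<le> 0 \<or> (\<exists>j\<in>{..<N}. ?Q x j))"
    by (cases "\<gamma> \<le> 0") simp_all
  have "interval_test N \<tau> \<gamma> x \<longleftrightarrow> \<gamma> \<le> 0 \<or> (\<exists>j\<in>{..<N}. ?Q x j)"
    if "x \<in> space (H0_law N)" for x
    using interval_test_iff[of N x \<tau> \<gamma>] PiE_mem[OF that[unfolded space_H0_law]] by blast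
  thus ?thesis unfolding is_test_iff
    by (rule measurable_cong[THEN iffD2, OF _ meas])
qed

text \<open>The point \<open>x j\<close> itself accounts for the summand \<open>1\<close>.\<close>

lemma p_fa_interval_test_le:
  assumes \<tau>: "0 < \<tau>" and \<gamma>: "0 < \<gamma>" and \<epsilon>: "0 \<le> \<epsilon>"
    and le: "\<And>j. j < N \<Longrightarrow> emeasure (H0_law N) {x \<in> space (H0_law N).
       \<gamma> \<le> 1 + real (card {i \<in> {..<N} - {j}. x i \<in> circ_arc \<tau> (x j)})} \<le> ennreal \<epsilon>"
  shows "p_fa N (interval_test N \<tau> \<gamma>) \<le> real N * \<epsilon>"
proof -
  let ?E = "\<lambda>j. {x \<in> space (H0_law N). \<gamma> \<le> 1 + real (card {i \<in> {..<N} - {j}. x i \<in> circ_arc \<tau> (x j)})}"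
  have E: "?E j \<in> sets (H0_law N)" if "j < N" for j
  proof -
    have [measurable]: "(\<lambda>x. real (card {i \<in> {..<N} - {j}. x i \<in> circ_arc \<tau> (x j)})) \<in> borel_measurable (H0_law N)"
      using that by (intro measurable_card_neighbours) auto
    show ?thesis by measurable
  qed
  have "{x \<in> space (H0_law N). interval_test N \<tau> \<gamma> x} \<subseteq> (\<Union>j<N. ?E j)"
  proof
    fix x assume x: "x \<in> {x \<in> space (H0_law N). interval_test N \<tau> \<gamma> x}"
    then obtain j where j: "j < N" "\<gamma> \<le> real (card {i \<in> {..<N}. x i \<in> circ_arc \<tau> (x j)})"
      using interval_test_iff[of N x \<tau> \<gamma>] \<gamma> PiE_mem[of x "{..<N}" "\<lambda>_. {0..<2 * pi}"]
      unfolding mem_Collect_eq space_H0_law by (meson lessThan_iff not_le)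
    have "{i \<in> {..<N}. x i \<in> circ_arc \<tau> (x j)} \<subseteq> insert j {i \<in> {..<N} - {j}. x i \<in> circ_arc \<tau> (x j)}"
      by auto
    hence "card {i \<in> {..<N}. x i \<in> circ_arc \<tau> (x j)} \<le> card (insert j {i \<in> {..<N} - {j}. x i \<in> circ_arc \<tau> (x j)})"
      by (intro card_mono) auto
    also have "\<dots> \<le> 1 + card {i \<in> {..<N} - {j}. x i \<in> circ_arc \<tau> (x j)}"
      by (simp add: card_insert_if)
    finally have "\<gamma> \<le> 1 + real (card {i \<in> {..<N} - {j}. x i \<in> circ_arc \<tau> (x j)})"
      using j(2) by linarith
    thus "x \<in> (\<Union>j<N. ?E j)" using j(1) x by blast
  qed
  hence "emeasure (H0_law N) {x \<in> space (H0_law N). interval_test N \<tau> \<gamma> x} \<le> emeasure (H0_law N) (\<Union>j<N. ?E j)"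
    using E by (intro emeasure_mono) auto
  also have "\<dots> \<le> (\<Sum>j<N. emeasure (H0_law N) (?E j))"
    using E by (intro emeasure_subadditive_finite) auto
  also have "\<dots> \<le> (\<Sum>j<N. ennreal \<epsilon>)"
    using le by (intro sum_mono) auto
  also have "\<dots> = ennreal (real N * \<epsilon>)"
    using \<epsilon> by (simp add: ennreal_mult ennreal_of_nat_eq_real_of_nat)
  finally show ?thesis
    unfolding p_fa_def using \<epsilon> by (simp add: H0.emeasure_eq_measure)
qed

text \<open>Where the planted likelihood does not vanish, all \<open>K\<close> planted points lie in the
planted window, so a miss means that the unplanted points fall short there.\<close>

lemma p_miss_interval_test_le:
  assumes \<tau>: "0 < \<tau>" "\<tau> < 1" and K: "K \<le> N" and \<epsilon>: "0 \<le> \<epsilon>"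
    and le: "\<And>S \<theta>. S \<subseteq> {..<N} \<Longrightarrow> card S = K \<Longrightarrow> \<theta> \<in> {0..<2 * pi} \<Longrightarrow>
      (\<integral>\<^sup>+x. planted_lik \<tau> S \<theta> x *
         (if K + real (card {i \<in> {..<N} - S. x i \<in> circ_arc \<tau> \<theta>}) < \<gamma> then 1 else 0) \<partial>H0_law N) \<le> ennreal \<epsilon>"
  shows "p_miss N K \<tau> (interval_test N \<tau> \<gamma>) \<le> \<epsilon>"
proof -
  let ?A = "{x \<in> space (H0_law N). \<not> interval_test N \<tau> \<gamma> x}"
  have sp: "space (H1_law N K \<tau>) = space (H0_law N)"
    by (rule sets_eq_imp_space_eq[OF sets_H1_law[OF \<tau> K]])
  have [measurable]: "Measurable.pred (H0_law N) (interval_test N \<tau> \<gamma>)"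
    using is_test_interval_test by (simp add: is_test_iff)
  have A: "?A \<in> sets (H0_law N)" by measurable
  have "emeasure (H1_law N K \<tau>) ?A \<le> ennreal \<epsilon>"
  proof (rule emeasure_H1_law_le[OF \<tau> K A])
    fix S \<theta> assume S: "S \<subseteq> {..<N}" "card S = K" and \<theta>: "\<theta> \<in> {0..<2 * pi}"
    have "(\<integral>\<^sup>+x. planted_lik \<tau> S \<theta> x * indicator ?A x \<partial>H0_law N)
      \<le> (\<integral>\<^sup>+x. planted_lik \<tau> S \<theta> x *
         (if K + real (card {i \<in> {..<N} - S. x i \<in> circ_arc \<tau> \<theta>}) < \<gamma> then 1 else 0) \<partial>H0_law N)"
    proof (intro nn_integral_mono)
      fix x assume x: "x \<in> space (H0_law N)"
      have finS: "finite S" using S finite_subset by blast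
      show "planted_lik \<tau> S \<theta> x * indicator ?A x
        \<le> planted_lik \<tau> S \<theta> x *
           (if K + real (card {i \<in> {..<N} - S. x i \<in> circ_arc \<tau> \<theta>}) < \<gamma> then 1 else 0)"
      proof (cases "planted_lik \<tau> S \<theta> x \<noteq> 0 \<and> \<not> interval_test N \<tau> \<gamma> x")
        case True
        hence "\<forall>i\<in>S. (if x i \<in> circ_arc \<tau> \<theta> then ennreal (1 / \<tau>) else 0) \<noteq> 0"
          using finS by (simp add: planted_lik_def)
        hence inS: "x i \<in> circ_arc \<tau> \<theta>" if "i \<in> S" for i
          using that by metis
        have "{i \<in> {..<N}. x i \<in> circ_arc \<tau> \<theta>} = S \<union> {i \<in> {..<N} - S. x i \<in> circ_arc \<tau> \<theta>}"
          using inS S by auto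
        hence "card {i \<in> {..<N}. x i \<in> circ_arc \<tau> \<theta>} = K + card {i \<in> {..<N} - S. x i \<in> circ_arc \<tau> \<theta>}"
          using finS by (simp only: S(2)[symmetric]) (rule card_Un_disjoint, auto)
        moreover have "real (card {i \<in> {..<N}. x i \<in> circ_arc \<tau> \<theta>}) < \<gamma>"
        proof -
          have "(\<Sum>i<N. indicat_real A (x i)) \<le> real N" for A
            using sum_bounded_above[of "{..<N}" "\<lambda>i. indicat_real A (x i)" 1] by (simp add: indicator_def)
          hence "bdd_above ((\<lambda>\<theta>. \<Sum>i<N. indicat_real (circ_arc \<tau> \<theta>) (x i)) ` {0..<2 * pi})"
            by (rule bdd_aboveI2)
          hence "(\<Sum>i<N. indicat_real (circ_arc \<tau> \<theta>) (x i))
              \<le> (SUP \<theta>\<in>{0..<2 * pi}. \<Sum>i<N. indicat_real (circ_arc \<tau> \<theta>) (x i))"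
            using \<theta> by (intro cSUP_upper)
          also have "\<dots> < \<gamma>" using True by (simp add: interval_test_def)
          finally show ?thesis by (simp add: sum_indicat_eq_card)
        qed
        ultimately show ?thesis by (simp add: indicator_def)
      qed (auto simp: indicator_def)
    qed
    also have "\<dots> \<le> ennreal \<epsilon>" by (rule le[OF S \<theta>])
    finally show "(\<integral>\<^sup>+x. planted_lik \<tau> S \<theta> x * indicator ?A x \<partial>H0_law N) \<le> ennreal \<epsilon>" .
  qed
  thus ?thesis unfolding p_miss_def sp measure_def
    using \<epsilon> by (intro enn2real_leI) auto
qed

section \<open>Tail bounds for the two error probabilities\<close>

text \<open>The difference vanishes at \<open>0\<close> and has derivative \<open>y\<^sup>2 / ((1 + y) (2 +
y)\<^sup>2) \<ge> 0\<close>.\<close>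

lemma ln_one_plus_ge:
  assumes "0 \<le> (x::real)"
  shows "2 * x / (2 + x) \<le> ln (1 + x)"
proof -
  let ?f = "\<lambda>x::real. ln (1 + x) - 2 * x / (2 + x)"
  have "?f 0 \<le> ?f x"
  proof (rule DERIV_nonneg_imp_nondecreasing[OF assms])
    fix y :: real assume y: "0 \<le> y"
    have "(?f has_real_derivative (1 / (1 + y) - (2 * (2 + y) - 2 * y) / (2 + y)\<^sup>2)) (at y)"
      using y by (auto intro!: derivative_eq_intros simp: power2_eq_square)
    moreover have "1 / (1 + y) - (2 * (2 + y) - 2 * y) / (2 + y)\<^sup>2 = y\<^sup>2 / ((1 + y) * (2 + y)\<^sup>2)"
    proof -
      have "1 + y \<noteq> 0" "(2 + y)\<^sup>2 \<noteq> 0" using y by auto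
      thus ?thesis by (simp add: diff_frac_eq) (simp add: power2_eq_square algebra_simps)
    qed
    ultimately show "\<exists>d. (?f has_real_derivative d) (at y) \<and> 0 \<le> d"
      using y by (intro exI[of _ "y\<^sup>2 / ((1 + y) * (2 + y)\<^sup>2)"] conjI) auto
  qed
  thus ?thesis by simp
qed

text \<open>Turns the optimal Chernoff exponent of a Poisson variable with mean \<open>\<mu>\<close> into the
rational form used in the threshold condition.\<close>

lemma chernoff_exponent_le:
  assumes "0 < \<mu>" "0 \<le> (t::real)"
  shows "t - (\<mu> + t) * ln (1 + t / \<mu>) \<le> - (t\<^sup>2 / (2 * \<mu> + t))"
proof -
  have pos: "2 * \<mu> + t > 0" using assms by linarith
  have "2 + t / \<mu> = (2 * \<mu> + t) / \<mu>"
    using assms by (simp add: add_divide_distrib)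
  hence eq: "2 * (t / \<mu>) / (2 + t / \<mu>) = 2 * t / (2 * \<mu> + t)"
    using assms by simp
  have "2 * t / (2 * \<mu> + t) \<le> ln (1 + t / \<mu>)"
    using ln_one_plus_ge[of "t / \<mu>"] assms unfolding eq by simp
  hence "(\<mu> + t) * (2 * t / (2 * \<mu> + t)) \<le> (\<mu> + t) * ln (1 + t / \<mu>)"
    using assms by (intro mult_left_mono) auto
  moreover have "(\<mu> + t) * (2 * t / (2 * \<mu> + t)) = t + t\<^sup>2 / (2 * \<mu> + t)"
    using pos by (simp add: field_simps power2_eq_square)
  ultimately show ?thesis by linarith
qed

lemma exp_minus_le_quadratic:
  assumes "0 \<le> (x::real)"
  shows "exp (- x) \<le> 1 - x + x\<^sup>2 / 2"
proof -
  have q: "0 < 1 + x + x\<^sup>2 / 2" using assms by (intro add_pos_nonneg) auto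
  have "1 \<le> (1 + x + x\<^sup>2 / 2) * (1 - x + x\<^sup>2 / 2)"
  proof -
    have "(1 + x + x\<^sup>2 / 2) * (1 - x + x\<^sup>2 / 2) = 1 + (x\<^sup>2 / 2)\<^sup>2"
      by (simp add: power2_eq_square field_simps)
    thus ?thesis by simp
  qed
  hence "1 / (1 + x + x\<^sup>2 / 2) \<le> 1 - x + x\<^sup>2 / 2"
    using q by (simp add: divide_le_eq mult.commute)
  moreover have "exp (- x) \<le> 1 / (1 + x + x\<^sup>2 / 2)"
    using exp_lower_Taylor_quadratic[OF assms] q
    by (simp add: exp_minus inverse_eq_divide frac_le)
  ultimately show ?thesis by linarith
qed

lemma prod_weight_eq_power:
  fixes b :: "'a :: comm_monoid_mult"
  assumes "finite J"
  shows "(\<Prod>i\<in>J. if P i then b else 1) = b ^ card {i \<in> J. P i}"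
  using assms by (simp add: prod.If_cases Int_def)

text \<open>The Chernoff bound with the weight \<open>b = 1 + t / \<mu>\<close>, the optimal one for a Poisson
variable of mean \<open>\<mu>\<close>; the binomial moment generating function is dominated by the
Poisson one.\<close>

lemma neighbour_count_upper_tail:
  assumes \<tau>: "0 < \<tau>" "\<tau> < 1" and j: "j < N" and t: "0 \<le> t" and \<mu>: "\<mu> = (real N - 1) * \<tau>" "0 < \<mu>"
  shows "emeasure (H0_law N) {x \<in> space (H0_law N).
      \<mu> + t \<le> real (card {i \<in> {..<N} - {j}. x i \<in> circ_arc \<tau> (x j)})}
    \<le> ennreal (exp (- (t\<^sup>2 / (2 * \<mu> + t))))"
proof -
  let ?c = "\<lambda>x. card {i \<in> {..<N} - {j}. x i \<in> circ_arc \<tau> (x j)}"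
  let ?E = "{x \<in> space (H0_law N). \<mu> + t \<le> real (?c x)}"
  define b where "b = 1 + t / \<mu>"
  have b: "1 \<le> b" "0 < b" using t \<mu> by (auto simp: b_def intro: add_pos_nonneg)
  have c_meas [measurable]: "(\<lambda>x. real (?c x)) \<in> borel_measurable (H0_law N)"
    using j by (intro measurable_card_neighbours) auto
  have E: "?E \<in> sets (H0_law N)" by measurable
  have G: "(\<lambda>x. \<Prod>i\<in>{..<N} - {j}. if x i \<in> circ_arc \<tau> (x j) then ennreal b else 1) \<in> borel_measurable (H0_law N)"
    using j by (intro borel_measurable_prod_ennreal) measurable
  have "emeasure (H0_law N) ?E = (\<integral>\<^sup>+x. indicator ?E x \<partial>H0_law N)"
    by (rule nn_integral_indicator[symmetric, OF E])
  also have "\<dots> \<le> (\<integral>\<^sup>+x. ennreal (b powr - (\<mu> + t)) *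
      (\<Prod>i\<in>{..<N} - {j}. if x i \<in> circ_arc \<tau> (x j) then ennreal b else 1) \<partial>H0_law N)"
  proof (intro nn_integral_mono)
    fix x
    have "(\<Prod>i\<in>{..<N} - {j}. if x i \<in> circ_arc \<tau> (x j) then ennreal b else 1) = ennreal (b powr real (?c x))"
      using b by (subst prod_weight_eq_power) (auto simp: ennreal_power powr_realpow)
    moreover have "ennreal (b powr - (\<mu> + t)) * ennreal (b powr real (?c x))
        = ennreal (b powr (real (?c x) - (\<mu> + t)))"
      by (subst ennreal_mult[symmetric]) (auto simp flip: powr_add simp: algebra_simps)
    moreover have "1 \<le> b powr (real (?c x) - (\<mu> + t))" if "x \<in> ?E"
      using that b by (intro ge_one_powr_ge_zero) auto
    ultimately show "indicator ?E x \<le> ennreal (b powr - (\<mu> + t)) *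
      (\<Prod>i\<in>{..<N} - {j}. if x i \<in> circ_arc \<tau> (x j) then ennreal b else 1)"
      by (auto simp: indicator_def)
  qed
  also have "\<dots> = ennreal (b powr - (\<mu> + t)) *
      (\<Prod>i\<in>{..<N} - {j}. ennreal b * ennreal \<tau> + 1 * ennreal (1 - \<tau>))"
    using G by (simp only: nn_integral_cmult nn_integral_H0_law_neighbours[OF \<tau> j])
  also have "\<dots> = ennreal (b powr - (\<mu> + t) * (b * \<tau> + (1 - \<tau>)) ^ (N - 1))"
  proof -
    have "ennreal b * ennreal \<tau> + 1 * ennreal (1 - \<tau>) = ennreal (b * \<tau> + (1 - \<tau>))"
      using b \<tau> by (simp flip: ennreal_mult ennreal_plus)
    moreover have "card ({..<N} - {j}) = N - 1" using j by simp
    ultimately have "(\<Prod>i\<in>{..<N} - {j}. ennreal b * ennreal \<tau> + 1 * ennreal (1 - \<tau>))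
        = ennreal (b * \<tau> + (1 - \<tau>)) ^ (N - 1)"
      by (simp only: prod_constant)
    also have "\<dots> = ennreal ((b * \<tau> + (1 - \<tau>)) ^ (N - 1))"
      using b \<tau> by (intro ennreal_power) auto
    finally show ?thesis using b \<tau> by (simp only:) (intro ennreal_mult[symmetric], auto)
  qed
  also have "\<dots> \<le> ennreal (exp (- (t\<^sup>2 / (2 * \<mu> + t))))"
  proof (intro ennreal_leI)
    have "b * \<tau> + (1 - \<tau>) = 1 + \<tau> * (t / \<mu>)" by (simp add: b_def algebra_simps)
    also have "\<dots> \<le> exp (\<tau> * (t / \<mu>))" by (rule exp_ge_add_one_self)
    finally have "(b * \<tau> + (1 - \<tau>)) ^ (N - 1) \<le> exp (\<tau> * (t / \<mu>)) ^ (N - 1)"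
      using b \<tau> by (intro power_mono) auto
    also have "\<dots> = exp (real (N - 1) * (\<tau> * (t / \<mu>)))" by (rule exp_of_nat_mult[symmetric])
    also have "real (N - 1) * (\<tau> * (t / \<mu>)) = t"
    proof -
      have "real (N - 1) * \<tau> = \<mu>" using j by (simp add: \<mu>(1) of_nat_diff)
      hence "real (N - 1) * (\<tau> * (t / \<mu>)) = \<mu> * (t / \<mu>)" by (simp only: mult.assoc[symmetric])
      thus ?thesis using \<mu>(2) by simp
    qed
    finally have "b powr - (\<mu> + t) * (b * \<tau> + (1 - \<tau>)) ^ (N - 1) \<le> b powr - (\<mu> + t) * exp t"
      by (intro mult_left_mono) auto
    also have "\<dots> = exp (t - (\<mu> + t) * ln (1 + t / \<mu>))"
      using b by (simp add: powr_def b_def[symmetric] exp_add[symmetric] algebra_simps)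
    also have "\<dots> \<le> exp (- (t\<^sup>2 / (2 * \<mu> + t)))"
      using chernoff_exponent_le[OF \<mu>(2) t] by simp
    finally show "b powr - (\<mu> + t) * (b * \<tau> + (1 - \<tau>)) ^ (N - 1) \<le> exp (- (t\<^sup>2 / (2 * \<mu> + t)))" .
  qed
  finally show ?thesis .
qed

text \<open>If at least \<open>m\<close> points are in the window, then some \<open>m\<close>-subset lies
entirely in it; each of the \<open>N - 1 choose m\<close> candidates does so with probability
\<open>\<tau> ^ m\<close>.\<close>

lemma neighbour_count_union_bound:
  assumes \<tau>: "0 < \<tau>" "\<tau> < 1" and j: "j < N"
  shows "emeasure (H0_law N) {x \<in> space (H0_law N).
      m \<le> card {i \<in> {..<N} - {j}. x i \<in> circ_arc \<tau> (x j)}} \<le> ennreal (real N ^ m * \<tau> ^ m / fact m)"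
proof -
  let ?J = "{..<N} - {j}"
  let ?E = "{x \<in> space (H0_law N). m \<le> card {i \<in> ?J. x i \<in> circ_arc \<tau> (x j)}}"
  let ?T = "{T. T \<subseteq> ?J \<and> card T = m}"
  let ?w = "\<lambda>T x. \<Prod>i\<in>?J. if x i \<in> circ_arc \<tau> (x j) then 1 else if i \<in> T then 0 else (1::ennreal)"
  have c_meas [measurable]: "(\<lambda>x. real (card {i \<in> ?J. x i \<in> circ_arc \<tau> (x j)})) \<in> borel_measurable (H0_law N)"
    using j by (intro measurable_card_neighbours) auto
  have "{x \<in> space (H0_law N). real m \<le> real (card {i \<in> ?J. x i \<in> circ_arc \<tau> (x j)})} \<in> sets (H0_law N)"
    by measurable
  hence E: "?E \<in> sets (H0_law N)" by (simp only: of_nat_le_iff)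
  have w_meas: "?w T \<in> borel_measurable (H0_law N)" for T
    using j by (intro borel_measurable_prod_ennreal) measurable
  have finT: "finite ?T" by (rule finite_subset[of _ "Pow ?J"]) auto
  have cardJ: "card ?J = N - 1" using j by simp
  have "emeasure (H0_law N) ?E = (\<integral>\<^sup>+x. indicator ?E x \<partial>H0_law N)"
    by (rule nn_integral_indicator[symmetric, OF E])
  also have "\<dots> \<le> (\<integral>\<^sup>+x. (\<Sum>T\<in>?T. ?w T x) \<partial>H0_law N)"
  proof (intro nn_integral_mono)
    fix x
    show "indicator ?E x \<le> (\<Sum>T\<in>?T. ?w T x)"
    proof (cases "x \<in> ?E")
      case True
      then obtain T where T: "T \<subseteq> {i \<in> ?J. x i \<in> circ_arc \<tau> (x j)}" "card T = m"
        by (auto elim: obtain_subset_with_card_n)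
      have "?w T x = 1" using T by (intro prod.neutral) auto
      moreover have "?w T x \<le> (\<Sum>T\<in>?T. ?w T x)"
        using T finT by (intro member_le_sum) auto
      ultimately show ?thesis by (simp add: indicator_def)
    qed simp
  qed
  also have "\<dots> = (\<Sum>T\<in>?T. \<integral>\<^sup>+x. ?w T x \<partial>H0_law N)"
    using w_meas by (intro nn_integral_sum) auto
  also have "\<dots> = (\<Sum>T\<in>?T. ennreal (\<tau> ^ m))"
  proof (intro sum.cong refl)
    fix T assume T: "T \<in> ?T"
    have "(\<integral>\<^sup>+x. ?w T x \<partial>H0_law N) = (\<Prod>i\<in>?J. 1 * ennreal \<tau> + (if i \<in> T then 0 else 1) * ennreal (1 - \<tau>))"
      by (rule nn_integral_H0_law_neighbours[OF \<tau> j])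
    also have "\<dots> = (\<Prod>i\<in>?J. if i \<in> T then ennreal \<tau> else 1)"
      using \<tau> by (intro prod.cong refl) (auto simp flip: ennreal_plus)
    also have "\<dots> = ennreal \<tau> ^ card {i \<in> ?J. i \<in> T}" by (rule prod_weight_eq_power) simp
    also have "{i \<in> ?J. i \<in> T} = T" using T by auto
    finally show "(\<integral>\<^sup>+x. ?w T x \<partial>H0_law N) = ennreal (\<tau> ^ m)"
      using T \<tau> by (simp add: ennreal_power)
  qed
  also have "\<dots> = ennreal (real (N - 1 choose m) * \<tau> ^ m)"
    using \<tau> n_subsets[of ?J m] cardJ by (simp add: ennreal_mult ennreal_of_nat_eq_real_of_nat)
  also have "\<dots> \<le> ennreal (real N ^ m * \<tau> ^ m / fact m)"
  proof (intro ennreal_leI)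
    have "real ((N - 1 choose m) * fact m) \<le> real ((N - 1) ^ m)"
      using binomial_fact_pow[of "N - 1" m] by (simp only: of_nat_le_iff)
    also have "\<dots> \<le> real N ^ m" by (simp add: power_mono)
    finally have "real (N - 1 choose m) \<le> real N ^ m / fact m"
      by (simp add: field_simps)
    thus "real (N - 1 choose m) * \<tau> ^ m \<le> real N ^ m * \<tau> ^ m / fact m"
      using \<tau> mult_right_mono[of "real (N - 1 choose m)" "real N ^ m / fact m" "\<tau> ^ m"] by simp
  qed
  finally show ?thesis .
qed

lemma p_fa_full_count:
  assumes \<tau>: "0 < \<tau>" "\<tau> < 1" and K: "1 \<le> K" "K \<le> N"
  shows "p_fa N (interval_test N \<tau> (real K)) \<le> real N ^ K * \<tau> ^ (K - 1) / fact (K - 1)"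
proof -
  have "p_fa N (interval_test N \<tau> (real K)) \<le> real N * (real N ^ (K - 1) * \<tau> ^ (K - 1) / fact (K - 1))"
  proof (rule p_fa_interval_test_le)
    fix j assume j: "j < N"
    have "{x \<in> space (H0_law N). real K \<le> 1 + real (card {i \<in> {..<N} - {j}. x i \<in> circ_arc \<tau> (x j)})}
        = {x \<in> space (H0_law N). K - 1 \<le> card {i \<in> {..<N} - {j}. x i \<in> circ_arc \<tau> (x j)}}"
      using K by auto
    thus "emeasure (H0_law N) {x \<in> space (H0_law N).
        real K \<le> 1 + real (card {i \<in> {..<N} - {j}. x i \<in> circ_arc \<tau> (x j)})}
      \<le> ennreal (real N ^ (K - 1) * \<tau> ^ (K - 1) / fact (K - 1))"
      using neighbour_count_union_bound[OF \<tau> j, of "K - 1"] by simp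
  qed (use \<tau> K in auto)
  also have "\<dots> = real N ^ Suc (K - 1) * \<tau> ^ (K - 1) / fact (K - 1)" by simp
  finally show ?thesis using K by simp
qed

lemma p_fa_chernoff:
  assumes \<tau>: "0 < \<tau>" "\<tau> < 1" and N: "2 \<le> N" and t: "0 \<le> t"
  shows "p_fa N (interval_test N \<tau> (1 + (real N - 1) * \<tau> + t))
    \<le> real N * exp (- (t\<^sup>2 / (2 * ((real N - 1) * \<tau>) + t)))"
proof (rule p_fa_interval_test_le)
  define \<mu> where "\<mu> = (real N - 1) * \<tau>"
  have \<mu>: "0 < \<mu>" using N \<tau> by (simp add: \<mu>_def)
  thus "0 < 1 + (real N - 1) * \<tau> + t" using t by (simp add: \<mu>_def)
  fix j assume j: "j < N"
  show "emeasure (H0_law N) {x \<in> space (H0_law N).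
      1 + (real N - 1) * \<tau> + t \<le> 1 + real (card {i \<in> {..<N} - {j}. x i \<in> circ_arc \<tau> (x j)})}
    \<le> ennreal (exp (- (t\<^sup>2 / (2 * ((real N - 1) * \<tau>) + t))))"
    using neighbour_count_upper_tail[OF \<tau> j t \<mu>_def \<mu>] unfolding \<mu>_def by (simp add: algebra_simps)
qed (use \<tau> in auto)

text \<open>The planted window alone contains \<open>K\<close> points.\<close>

lemma p_miss_full_count:
  assumes \<tau>: "0 < \<tau>" "\<tau> < 1" and K: "K \<le> N"
  shows "p_miss N K \<tau> (interval_test N \<tau> (real K)) \<le> 0"
  by (rule p_miss_interval_test_le[OF \<tau> K]) auto

text \<open>Let \<open>s\<^sup>2 = (N - K) \<tau>\<close> be the mean number of unplanted points in the
planted window. A miss means that this number is below \<open>s\<^sup>2 - c s\<close>, and the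
lower-tail Chernoff bound with parameter \<open>\<beta> = c / s\<close> gives \<open>exp (- c s
\<beta> + s\<^sup>2 \<beta>\<^sup>2 / 2) = exp (- c\<^sup>2 / 2)\<close>. If \<open>s = 0\<close>
then \<open>K = N\<close> and the threshold is \<open>K\<close>, so no miss is possible.\<close>

lemma p_miss_chernoff:
  assumes \<tau>: "0 < \<tau>" "\<tau> < 1" and K: "K \<le> N" and c: "0 \<le> c"
  shows "p_miss N K \<tau> (interval_test N \<tau>
      ((real N - real K) * \<tau> + real K - c * sqrt ((real N - real K) * \<tau>))) \<le> exp (- (c\<^sup>2 / 2))"
proof -
  define n where "n = N - K"
  define s where "s = sqrt (real n * \<tau>)"
  have n: "real n = real N - real K" using K by (simp add: n_def of_nat_diff)
  have s0: "0 \<le> s" and s2: "s\<^sup>2 = real n * \<tau>" using \<tau> by (simp_all add: s_def)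
  have "p_miss N K \<tau> (interval_test N \<tau> (real n * \<tau> + real K - c * s)) \<le> exp (- (c\<^sup>2 / 2))"
  proof (cases "n = 0")
    case True
    hence eq: "real n * \<tau> + real K - c * s = real K" by (simp add: s_def)
    have "p_miss N K \<tau> (interval_test N \<tau> (real K)) \<le> 0"
      by (rule p_miss_full_count[OF \<tau> K])
    also have "0 \<le> exp (- (c\<^sup>2 / 2))" by simp
    finally show ?thesis unfolding eq .
  next
    case False
    hence s: "0 < s" using \<tau> by (simp add: s_def)
    define \<beta> where "\<beta> = c / s"
    have \<beta>: "0 \<le> \<beta>" and \<beta>s: "\<beta> * s = c" using c s by (simp_all add: \<beta>_def)
    show ?thesis
    proof (rule p_miss_interval_test_le[OF \<tau> K])
      fix S \<theta> assume S: "S \<subseteq> {..<N}" "card S = K" and \<theta>: "\<theta> \<in> {0..<2 * pi}"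
      let ?d = "\<lambda>x. card {i \<in> {..<N} - S. x i \<in> circ_arc \<tau> \<theta>}"
      let ?w = "\<lambda>x. \<Prod>i\<in>{..<N} - S. if x i \<in> circ_arc \<tau> \<theta> then ennreal (exp (- \<beta>)) else 1"
      let ?C = "ennreal (exp (\<beta> * (s\<^sup>2 - c * s)))"
      have [measurable]: "?w \<in> borel_measurable (H0_law N)"
      proof (rule borel_measurable_prod_ennreal)
        fix i assume "i \<in> {..<N} - S"
        hence "i < N" by simp
        from measurable_compose[OF measurable_H0_law_component[OF this] borel_measurable_circ_arc_weight[OF \<theta>]]
        show "(\<lambda>x. if x i \<in> circ_arc \<tau> \<theta> then ennreal (exp (- \<beta>)) else 1) \<in> borel_measurable (H0_law N)" .
      qed
      have [measurable]: "planted_lik \<tau> S \<theta> \<in> borel_measurable (H0_law N)"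
        using measurable_planted_lik[OF S(1), of "\<lambda>_. \<theta>" "H0_law N" "\<lambda>x. x" \<tau>] \<theta> by simp
      have "(\<integral>\<^sup>+x. planted_lik \<tau> S \<theta> x *
           (if real K + real (?d x) < real n * \<tau> + real K - c * s then 1 else 0) \<partial>H0_law N)
        \<le> (\<integral>\<^sup>+x. ?C * (planted_lik \<tau> S \<theta> x * ?w x) \<partial>H0_law N)"
      proof (intro nn_integral_mono)
        fix x
        have "?w x = ennreal (exp (- \<beta>) ^ ?d x)"
          by (subst prod_weight_eq_power) (auto simp: ennreal_power)
        also have "exp (- \<beta>) ^ ?d x = exp (- \<beta> * real (?d x))"
          by (simp add: exp_of_nat_mult[symmetric] mult.commute)
        finally have w: "?C * ?w x = ennreal (exp (\<beta> * (s\<^sup>2 - c * s - real (?d x))))"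
          by (simp add: ennreal_mult[symmetric] exp_add[symmetric] algebra_simps)
        have "(if real K + real (?d x) < real n * \<tau> + real K - c * s then 1 else 0) \<le> ?C * ?w x"
        proof (cases "real K + real (?d x) < real n * \<tau> + real K - c * s")
          case True
          hence "0 \<le> \<beta> * (s\<^sup>2 - c * s - real (?d x))" using \<beta> by (intro mult_nonneg_nonneg) (auto simp: s2)
          thus ?thesis unfolding w by simp
        qed simp
        hence "planted_lik \<tau> S \<theta> x * (if real K + real (?d x) < real n * \<tau> + real K - c * s then 1 else 0)
           \<le> planted_lik \<tau> S \<theta> x * (?C * ?w x)"
          by (rule mult_left_mono) simp
        thus "planted_lik \<tau> S \<theta> x * (if real K + real (?d x) < real n * \<tau> + real K - c * s then 1 else 0)
           \<le> ?C * (planted_lik \<tau> S \<theta> x * ?w x)"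
          by (simp only: mult.left_commute)
      qed
      also have "\<dots> = ?C * (ennreal (exp (- \<beta>)) * ennreal \<tau> + ennreal (1 - \<tau>)) ^ n"
        unfolding n_def S(2)[symmetric] nn_integral_planted_weight[OF \<theta> \<tau> S(1), symmetric]
        by (rule nn_integral_cmult) measurable
      also have "ennreal (exp (- \<beta>)) * ennreal \<tau> + ennreal (1 - \<tau>) = ennreal (1 - \<tau> * (1 - exp (- \<beta>)))"
        using \<tau> by (simp add: ennreal_mult[symmetric] ennreal_plus[symmetric] algebra_simps del: ennreal_plus)
      also have "?C * ennreal (1 - \<tau> * (1 - exp (- \<beta>))) ^ n
          \<le> ?C * ennreal (exp (- (\<tau> * (1 - exp (- \<beta>))))) ^ n"
        using exp_ge_add_one_self[of "- (\<tau> * (1 - exp (- \<beta>)))"]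
        by (intro mult_left_mono power_mono ennreal_leI) auto
      also have "\<dots> = ennreal (exp (\<beta> * (s\<^sup>2 - c * s) - s\<^sup>2 * (1 - exp (- \<beta>))))"
        by (simp add: ennreal_power exp_of_nat_mult[symmetric] ennreal_mult[symmetric] exp_add[symmetric] s2 algebra_simps)
      also have "\<dots> \<le> ennreal (exp (- (c\<^sup>2 / 2)))"
      proof -
        have "s\<^sup>2 * (\<beta> - \<beta>\<^sup>2 / 2) \<le> s\<^sup>2 * (1 - exp (- \<beta>))"
          using exp_minus_le_quadratic[OF \<beta>] by (intro mult_left_mono) auto
        moreover have "s\<^sup>2 * (\<beta> - \<beta>\<^sup>2 / 2) = s * c - c\<^sup>2 / 2"
          unfolding \<beta>s[symmetric] by (simp add: power2_eq_square algebra_simps)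
        moreover have "\<beta> * (s\<^sup>2 - c * s) = s * c - c\<^sup>2"
          unfolding \<beta>s[symmetric] by (simp add: power2_eq_square algebra_simps)
        ultimately have "\<beta> * (s\<^sup>2 - c * s) - s\<^sup>2 * (1 - exp (- \<beta>)) \<le> - (c\<^sup>2 / 2)"
          by linarith
        thus ?thesis by (intro ennreal_leI) simp
      qed
      finally show "(\<integral>\<^sup>+x. planted_lik \<tau> S \<theta> x *
           (if real K + real (?d x) < real n * \<tau> + real K - c * s then 1 else 0) \<partial>H0_law N)
         \<le> ennreal (exp (- (c\<^sup>2 / 2)))" .
    qed simp
  qed
  thus ?thesis by (simp add: n s_def)
qed

section \<open>The second moment of the likelihood ratio\<close>

text \<open>The second-moment method for a likelihood ratio \<open>L\<close>: the two measures of
\<open>A\<close> differ by the mean of \<open>1\<^sub>A (L - 1)\<close>, whose square is at most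
the mean of \<open>(L - 1)\<^sup>2\<close>, that is, the second moment of \<open>L\<close> minus
\<open>1\<close>.\<close>

lemma measure_ge_of_second_moment:
  assumes "prob_space Q" and L [measurable]: "L \<in> borel_measurable Q"
    and mean: "(\<integral>\<^sup>+x. L x \<partial>Q) = 1" and second: "(\<integral>\<^sup>+x. (L x)\<^sup>2 \<partial>Q) \<le> ennreal (1 + \<delta>)"
    and \<delta>: "0 \<le> \<delta>" and A [measurable]: "A \<in> sets Q"
  shows "measure Q A - sqrt \<delta> \<le> enn2real (\<integral>\<^sup>+x. L x * indicator A x \<partial>Q)"
proof -
  interpret prob_space Q by fact
  define l where "l x = enn2real (L x)" for x
  have l_meas [measurable]: "l \<in> borel_measurable Q" unfolding l_def by measurable
  have l0: "0 \<le> l x" for x by (simp add: l_def)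
  have AE: "AE x in Q. L x = ennreal (l x)"
  proof -
    have "AE x in Q. L x \<noteq> \<infinity>" using mean by (intro nn_integral_PInf_AE) auto
    thus ?thesis by eventually_elim (simp add: l_def less_top)
  qed
  have m1: "(\<integral>\<^sup>+x. ennreal (l x) \<partial>Q) = 1"
    unfolding mean[symmetric] using AE by (intro nn_integral_cong_AE) auto
  have m2: "(\<integral>\<^sup>+x. ennreal ((l x)\<^sup>2) \<partial>Q) \<le> ennreal (1 + \<delta>)"
  proof -
    have "(\<integral>\<^sup>+x. ennreal ((l x)\<^sup>2) \<partial>Q) = (\<integral>\<^sup>+x. (L x)\<^sup>2 \<partial>Q)"
      using AE l0 by (intro nn_integral_cong_AE) (auto simp: ennreal_power)
    thus ?thesis using second by simp
  qed
  have int1 [simp]: "integrable Q l"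
    using m1 l0 by (intro integrableI_nonneg) auto
  have "(\<integral>\<^sup>+x. ennreal ((l x)\<^sup>2) \<partial>Q) < \<infinity>"
    using m2 by (rule order.strict_trans1) simp
  hence int2 [simp]: "integrable Q (\<lambda>x. (l x)\<^sup>2)"
    by (intro integrableI_nonneg) auto
  have e1: "expectation l = 1"
    using m1 l0 by (simp add: nn_integral_eq_integral)
  have e2: "expectation (\<lambda>x. (l x)\<^sup>2) \<le> 1 + \<delta>"
    using m2 \<delta> by (simp add: nn_integral_eq_integral del: ennreal_plus)
  define g where "g x = indicator A x * (l x - 1)" for x
  have g2: "(g x)\<^sup>2 = indicator A x * ((l x)\<^sup>2 - 2 * l x + 1)" for x
    by (simp add: g_def indicator_def power2_eq_square algebra_simps)
  have intg: "integrable Q g"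
    unfolding g_def using integrable_real_mult_indicator[OF A, of "\<lambda>x. l x - 1"] by (simp add: mult.commute)
  have intq: "integrable Q (\<lambda>x. (l x)\<^sup>2 - 2 * l x + 1)" by simp
  have intg2: "integrable Q (\<lambda>x. (g x)\<^sup>2)"
    unfolding g2 using integrable_real_mult_indicator[OF A intq] by (simp add: mult.commute)
  have "(expectation g)\<^sup>2 \<le> expectation (\<lambda>x. (g x)\<^sup>2)"
    using variance_eq[OF intg intg2] variance_positive[of g] by linarith
  also have "\<dots> \<le> expectation (\<lambda>x. (l x)\<^sup>2 - 2 * l x + 1)"
  proof (rule integral_mono[OF intg2 intq])
    fix x
    have "(l x)\<^sup>2 - 2 * l x + 1 = (l x - 1)\<^sup>2" by (simp add: power2_eq_square algebra_simps)
    thus "(g x)\<^sup>2 \<le> (l x)\<^sup>2 - 2 * l x + 1" by (simp add: g2 indicator_def)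
  qed
  also have "\<dots> = expectation (\<lambda>x. (l x)\<^sup>2) - 1"
    by (simp add: e1 prob_space)
  also have "\<dots> \<le> \<delta>" using e2 by simp
  finally have "\<bar>expectation g\<bar> \<le> sqrt \<delta>"
    using real_sqrt_le_mono by fastforce
  moreover have "enn2real (\<integral>\<^sup>+x. L x * indicator A x \<partial>Q) = expectation (\<lambda>x. indicator A x * l x)"
  proof -
    have "(\<integral>\<^sup>+x. L x * indicator A x \<partial>Q) = (\<integral>\<^sup>+x. ennreal (indicator A x * l x) \<partial>Q)"
      using AE l0 by (intro nn_integral_cong_AE) (auto simp: indicator_def)
    also have "\<dots> = ennreal (expectation (\<lambda>x. indicator A x * l x))"
      using integrable_real_mult_indicator[OF A int1] l0
      by (intro nn_integral_eq_integral) (auto simp: mult.commute)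
    finally show ?thesis using l0 by simp
  qed
  moreover have "expectation g = expectation (\<lambda>x. indicator A x * l x) - measure Q A"
  proof -
    have "integrable Q (indicat_real A)"
      by (intro integrable_real_indicator A) (simp add: emeasure_eq_measure)
    moreover have "expectation g = expectation (\<lambda>x. indicator A x * l x - indicator A x)"
      by (intro Bochner_Integration.integral_cong) (auto simp: g_def algebra_simps)
    ultimately have "expectation g = expectation (\<lambda>x. indicator A x * l x) - expectation (indicator A)"
      using integrable_real_mult_indicator[OF A int1] by (simp add: mult.commute)
    thus ?thesis by simp
  qed
  ultimately show ?thesis by linarith
qed

text \<open>The left side counts the \<open>K\<close>-subsets that contain \<open>h\<close> given elements;
prescribing one more element multiplies the count by \<open>(K - h) / (N - h) \<le> K / N\<close>.\<close>

lemma binomial_shrink_le: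
  assumes "h \<le> K" "K \<le> N"
  shows "real (N - h choose (K - h)) \<le> (real K / real N) ^ h * real (N choose K)"
  using assms(1)
proof (induction h)
  case (Suc h)
  have "(N - h) * (N - Suc h choose (K - Suc h)) = (K - h) * (N - h choose (K - h))"
    using Suc.prems assms(2) binomial_absorption[of "K - Suc h" "N - h"] by (simp add: Suc_diff_Suc)
  hence eq: "real (N - h) * real (N - Suc h choose (K - Suc h)) = real (K - h) * real (N - h choose (K - h))"
    by (metis of_nat_mult)
  have N: "real N > 0" "real (N - h) > 0" using Suc.prems assms(2) by auto
  have "real h * real K \<le> real h * real N"
    using assms(2) by (intro mult_left_mono) auto
  hence "real (K - h) * real N \<le> real K * real (N - h)"
    using Suc.prems assms(2) by (simp add: of_nat_diff algebra_simps)
  hence r: "real (K - h) / real (N - h) \<le> real K / real N"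
    using N by (simp add: divide_le_eq le_divide_eq mult.commute)
  have "real (N - Suc h choose (K - Suc h)) = real (K - h) / real (N - h) * real (N - h choose (K - h))"
    using eq N by (simp add: field_simps)
  also have "\<dots> \<le> real K / real N * ((real K / real N) ^ h * real (N choose K))"
    using Suc r by (intro mult_mono) auto
  finally show ?case by simp
qed simp

lemma card_supersets_le:
  assumes T: "T \<subseteq> {..<N}" "card T \<le> K" and K: "K \<le> N"
  shows "real (card {S. S \<subseteq> {..<N} \<and> card S = K \<and> T \<subseteq> S}) \<le> (real K / real N) ^ card T * real (N choose K)"
proof -
  have finT: "finite T" using T finite_subset by blast
  have "card {S. S \<subseteq> {..<N} \<and> card S = K \<and> T \<subseteq> S}
      \<le> card {R. R \<subseteq> {..<N} - T \<and> card R = K - card T}"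
  proof (rule card_inj_on_le[where f = "\<lambda>S. S - T"])
    show "inj_on (\<lambda>S. S - T) {S. S \<subseteq> {..<N} \<and> card S = K \<and> T \<subseteq> S}"
      by (rule inj_onI) blast
    show "(\<lambda>S. S - T) ` {S. S \<subseteq> {..<N} \<and> card S = K \<and> T \<subseteq> S}
        \<subseteq> {R. R \<subseteq> {..<N} - T \<and> card R = K - card T}"
      using finT by (auto simp: card_Diff_subset)
    show "finite {R. R \<subseteq> {..<N} - T \<and> card R = K - card T}"
      by (rule finite_subset[of _ "Pow {..<N}"]) auto
  qed
  also have "\<dots> = (N - card T choose (K - card T))"
    using T finT by (simp add: n_subsets card_Diff_subset)
  finally have "real (card {S. S \<subseteq> {..<N} \<and> card S = K \<and> T \<subseteq> S}) \<le> real (N - card T choose (K - card T))"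
    by simp
  also have "\<dots> \<le> (real K / real N) ^ card T * real (N choose K)"
    by (rule binomial_shrink_le[OF T(2) K])
  finally show ?thesis .
qed

lemma sum_card_subsets:
  fixes f :: "nat \<Rightarrow> real"
  assumes "finite S"
  shows "(\<Sum>T\<in>Pow S. f (card T)) = (\<Sum>h\<le>card S. real (card S choose h) * f h)"
proof -
  have "(\<Sum>T\<in>Pow S. f (card T)) = (\<Sum>h\<le>card S. \<Sum>T\<in>{T \<in> Pow S. card T = h}. f (card T))"
    using assms by (intro sum.group[symmetric]) (auto intro: card_mono)
  also have "\<dots> = (\<Sum>h\<le>card S. real (card {T. T \<subseteq> S \<and> card T = h}) * f h)"
    by (intro sum.cong refl) simp
  finally show ?thesis using assms by (simp add: n_subsets)
qed

text \<open>Group the sets by their trace \<open>T\<close> on \<open>S\<close>, and replace the condition that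
the trace equals \<open>T\<close> by the weaker condition that \<open>T\<close> is contained in
the set; the latter count does not depend on \<open>T\<close> beyond its size.\<close>

lemma sum_overlap_le:
  fixes f :: "nat \<Rightarrow> real"
  assumes S: "S \<subseteq> {..<N}" "card S = K" and f: "\<And>h. 0 \<le> f h"
  shows "(\<Sum>S' | S' \<subseteq> {..<N} \<and> card S' = K. f (card (S \<inter> S')))
    \<le> real (N choose K) * (\<Sum>h\<le>K. real (K choose h) * (real K / real N) ^ h * f h)"
proof -
  let ?F = "{S'. S' \<subseteq> {..<N} \<and> card S' = K}"
  have finS: "finite S" using S finite_subset by blast
  have K: "K \<le> N" using S card_mono[of "{..<N}" S] by simp
  have finF: "finite ?F" by (rule finite_subset[of _ "Pow {..<N}"]) auto
  have "(\<Sum>S'\<in>?F. f (card (S \<inter> S'))) = (\<Sum>T\<in>Pow S. \<Sum>S'\<in>{S' \<in> ?F. S \<inter> S' = T}. f (card (S \<inter> S')))"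
    using finF finS by (intro sum.group[symmetric]) auto
  also have "\<dots> \<le> (\<Sum>T\<in>Pow S. (real K / real N) ^ card T * real (N choose K) * f (card T))"
  proof (intro sum_mono)
    fix T assume T: "T \<in> Pow S"
    hence T': "T \<subseteq> {..<N}" "card T \<le> K" using S finS card_mono[of S T] by auto
    have "(\<Sum>S'\<in>{S' \<in> ?F. S \<inter> S' = T}. f (card (S \<inter> S'))) = real (card {S' \<in> ?F. S \<inter> S' = T}) * f (card T)"
      by simp
    also have "card {S' \<in> ?F. S \<inter> S' = T} \<le> card {S. S \<subseteq> {..<N} \<and> card S = K \<and> T \<subseteq> S}"
      using finite_subset[of "{S. S \<subseteq> {..<N} \<and> card S = K \<and> T \<subseteq> S}" ?F] finF by (intro card_mono) auto
    hence "real (card {S' \<in> ?F. S \<inter> S' = T}) * f (card T)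
        \<le> real (card {S. S \<subseteq> {..<N} \<and> card S = K \<and> T \<subseteq> S}) * f (card T)"
      using f by (intro mult_right_mono) auto
    also have "\<dots> \<le> (real K / real N) ^ card T * real (N choose K) * f (card T)"
      using f by (intro mult_right_mono card_supersets_le T' K) auto
    finally show "(\<Sum>S'\<in>{S' \<in> ?F. S \<inter> S' = T}. f (card (S \<inter> S')))
        \<le> (real K / real N) ^ card T * real (N choose K) * f (card T)" .
  qed
  also have "\<dots> = (\<Sum>h\<le>K. real (K choose h) * ((real K / real N) ^ h * real (N choose K) * f h))"
    using sum_card_subsets[OF finS, of "\<lambda>h. (real K / real N) ^ h * real (N choose K) * f h"] S(2) by simp
  also have "\<dots> = real (N choose K) * (\<Sum>h\<le>K. real (K choose h) * (real K / real N) ^ h * f h)"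
    by (simp add: sum_distrib_left mult_ac)
  finally show ?thesis .
qed

text \<open>With \<open>x = K / (N \<tau>)\<close> the identity \<open>(K choose h) / (h + 1) = (K + 1 choose
h + 1) / (K + 1)\<close> turns the sum into a multiple of the binomial expansion of \<open>(1 + x)
^ (K + 1)\<close> without its first term.\<close>

lemma overlap_series_le:
  assumes \<tau>: "0 < \<tau>" and K: "1 \<le> K" "K \<le> N"
  shows "(\<Sum>h\<le>K. real (K choose h) * (real K / real N) ^ h * (2 * \<tau> / (\<tau> ^ h * real (h + 1))))
    \<le> 2 * real N * \<tau>\<^sup>2 / (real K)\<^sup>2 * (1 + real K / (real N * \<tau>)) ^ (K + 1)"
proof -
  define x where "x = real K / (real N * \<tau>)"
  have pos: "0 < x" "0 < real K" "0 < real N" using \<tau> K by (auto simp: x_def)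
  define C where "C = 2 * \<tau> / (real (K + 1) * x)"
  have C: "0 \<le> C" using pos \<tau> by (simp add: C_def)
  have "(\<Sum>h\<le>K. real (K choose h) * (real K / real N) ^ h * (2 * \<tau> / (\<tau> ^ h * real (h + 1))))
      = (\<Sum>h\<le>K. C * (real (Suc K choose Suc h) * x ^ Suc h))"
  proof (intro sum.cong refl)
    fix h
    have "Suc h * (Suc K choose Suc h) = Suc K * (K choose h)"
      using Suc_times_binomial_eq[of K h] by (simp only: mult.commute)
    hence "real (Suc h) * real (Suc K choose Suc h) = real (Suc K) * real (K choose h)"
      by (metis of_nat_mult)
    hence b: "real (Suc K choose Suc h) = real (Suc K) * real (K choose h) / real (Suc h)"
      by (simp add: field_simps del: binomial_Suc_Suc)
    have x: "x ^ h = (real K / real N) ^ h / \<tau> ^ h"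
      by (simp add: x_def power_divide power_mult_distrib)
    have "C * (real (Suc K choose Suc h) * x ^ Suc h)
        = (C * real (Suc K) * x) * (real (K choose h) / real (Suc h) * x ^ h)"
      unfolding b by (simp add: mult_ac)
    also have "C * real (Suc K) * x = 2 * \<tau>" using pos by (simp add: C_def)
    finally show "real (K choose h) * (real K / real N) ^ h * (2 * \<tau> / (\<tau> ^ h * real (h + 1)))
        = C * (real (Suc K choose Suc h) * x ^ Suc h)"
      unfolding x by (simp add: mult_ac)
  qed
  also have "\<dots> = C * (\<Sum>j\<in>Suc ` {..K}. real (Suc K choose j) * x ^ j)"
    by (simp only: sum.reindex[OF inj_on_subset[OF inj_Suc subset_UNIV]] o_def sum_distrib_left)
  also have "\<dots> \<le> C * (\<Sum>j\<le>Suc K. real (Suc K choose j) * x ^ j)"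
    using C pos by (intro mult_left_mono sum_mono2) auto
  also have "(\<Sum>j\<le>Suc K. real (Suc K choose j) * x ^ j) = (1 + x) ^ (K + 1)"
    using binomial_ring[of x 1 "Suc K"] by (simp add: add.commute del: binomial_Suc_Suc power_Suc)
  also have "C * (1 + x) ^ (K + 1) \<le> 2 * real N * \<tau>\<^sup>2 / (real K)\<^sup>2 * (1 + x) ^ (K + 1)"
  proof (intro mult_right_mono)
    have "C = 2 * real N * \<tau>\<^sup>2 / (real (K + 1) * real K)"
      using pos \<tau> by (simp add: C_def x_def power2_eq_square)
    also have "\<dots> \<le> 2 * real N * \<tau>\<^sup>2 / (real K)\<^sup>2"
      using pos \<tau> unfolding power2_eq_square by (intro divide_left_mono mult_right_mono) auto
    finally show "C \<le> 2 * real N * \<tau>\<^sup>2 / (real K)\<^sup>2" .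
  qed (use pos in simp)
  finally show ?thesis unfolding x_def .
qed

text \<open>The additive \<open>1\<close> is the value for disjoint sets; adding it for all overlaps isolates
the second summand as a bound for the excess over \<open>1\<close> of the second moment.\<close>

lemma nn_integral_planted_lik_mult_le:
  assumes \<tau>: "0 < \<tau>" "\<tau> \<le> 1 / 2" and S: "S \<subseteq> {..<N}" "S' \<subseteq> {..<N}" and \<theta>: "\<theta> \<in> {0..<2 * pi}"
  shows "(\<integral>\<^sup>+\<theta>'. (\<integral>\<^sup>+x. planted_lik \<tau> S \<theta> x * planted_lik \<tau> S' \<theta>' x \<partial>H0_law N) \<partial>uniform_angle)
    \<le> ennreal (1 + 2 * \<tau> / (\<tau> ^ card (S \<inter> S') * real (card (S \<inter> S') + 1)))"
proof -
  define h where "h = card (S \<inter> S')"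
  have \<tau>1: "\<tau> < 1" using \<tau> by simp
  let ?I = "\<lambda>\<theta>'. emeasure uniform_angle (circ_arc \<tau> \<theta> \<inter> circ_arc \<tau> \<theta>')"
  have "(\<integral>\<^sup>+\<theta>'. (\<integral>\<^sup>+x. planted_lik \<tau> S \<theta> x * planted_lik \<tau> S' \<theta>' x \<partial>H0_law N) \<partial>uniform_angle)
      = (\<integral>\<^sup>+\<theta>'. (ennreal (1 / \<tau>\<^sup>2) * ?I \<theta>') ^ h \<partial>uniform_angle)"
    unfolding h_def using \<theta> \<tau> \<tau>1 S by (intro nn_integral_cong nn_integral_planted_lik_mult) auto
  also have "\<dots> \<le> ennreal (1 + 2 * \<tau> / (\<tau> ^ h * real (h + 1)))"
  proof (cases "h = 0")
    case True
    thus ?thesis using \<tau> by (simp add: angle.emeasure_space_1 del: space_uniform_angle ennreal_plus)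
  next
    case False
    have "(\<integral>\<^sup>+\<theta>'. (ennreal (1 / \<tau>\<^sup>2) * ?I \<theta>') ^ h \<partial>uniform_angle)
        \<le> ennreal (1 / \<tau>\<^sup>2) ^ h * (\<integral>\<^sup>+\<theta>'. ?I \<theta>' ^ h \<partial>uniform_angle)"
    proof -
      have "?I \<in> borel_measurable uniform_angle"
        using measurable_overlap[OF \<theta>, of \<tau>] by (simp cong: measurable_cong_sets)
      hence "(\<lambda>\<theta>'. ?I \<theta>' ^ h) \<in> borel_measurable uniform_angle"
        by (rule borel_measurable_power_ennreal)
      thus ?thesis unfolding power_mult_distrib by (simp add: nn_integral_cmult)
    qed
    also have "\<dots> \<le> ennreal (1 / \<tau>\<^sup>2) ^ h * ennreal (2 * \<tau> ^ (h + 1) / (h + 1))"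
      using False \<tau> \<theta> by (intro mult_left_mono nn_integral_overlap_power) auto
    also have "\<dots> = ennreal ((1 / \<tau>\<^sup>2) ^ h * (2 * \<tau> ^ (h + 1) / (h + 1)))"
      using \<tau> by (simp only: ennreal_power zero_le_divide_1_iff zero_le_power2) (intro ennreal_mult[symmetric], auto)
    also have "(1 / \<tau>\<^sup>2) ^ h * (2 * \<tau> ^ (h + 1) / (h + 1)) = 2 * \<tau> / (\<tau> ^ h * real (h + 1))"
      using \<tau> by (simp add: power_divide power2_eq_square power_mult_distrib)
    finally show ?thesis by (rule order_trans) (intro ennreal_leI, simp)
  qed
  finally show ?thesis unfolding h_def .
qed

text \<open>The likelihood ratio of the alternative against the null law, see
\<open>emeasure_H1_law_mixture_lik\<close>.\<close>

definition mixture_lik :: "nat \<Rightarrow> nat \<Rightarrow> real \<Rightarrow> (nat \<Rightarrow> real) \<Rightarrow> ennreal" where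
  "mixture_lik N K \<tau> x =
     (\<Sum>S | S \<subseteq> {..<N} \<and> card S = K. \<integral>\<^sup>+\<theta>. planted_lik \<tau> S \<theta> x \<partial>uniform_angle) / of_nat (N choose K)"

lemma measurable_planted_lik_pair:
  assumes "S \<subseteq> {..<N}"
  shows "(\<lambda>p. planted_lik \<tau> S (fst p) (snd p)) \<in> borel_measurable (uniform_angle \<Otimes>\<^sub>M H0_law N)"
    and "(\<lambda>p. planted_lik \<tau> S (snd p) (fst p)) \<in> borel_measurable (H0_law N \<Otimes>\<^sub>M uniform_angle)"
  by (rule measurable_planted_lik[OF assms]; auto cong: measurable_cong_sets)+

lemma measurable_nn_integral_planted_lik:
  assumes "S \<subseteq> {..<N}"
  shows "(\<lambda>x. \<integral>\<^sup>+\<theta>. planted_lik \<tau> S \<theta> x \<partial>uniform_angle) \<in> borel_measurable (H0_law N)"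
  using measurable_planted_lik_pair(2)[OF assms, of \<tau>]
  by (intro angle.borel_measurable_nn_integral) (simp add: split_beta)

lemma measurable_mixture_lik: "mixture_lik N K \<tau> \<in> borel_measurable (H0_law N)"
  unfolding mixture_lik_def
  by (intro borel_measurable_divide_ennreal borel_measurable_sum measurable_nn_integral_planted_lik) auto

lemma swap_planted_phase:
  assumes [measurable]: "g \<in> borel_measurable (H0_law N)" and S: "S \<subseteq> {..<N}"
  shows "(\<integral>\<^sup>+x. (\<integral>\<^sup>+\<theta>. planted_lik \<tau> S \<theta> x \<partial>uniform_angle) * g x \<partial>H0_law N)
     = (\<integral>\<^sup>+\<theta>. (\<integral>\<^sup>+x. planted_lik \<tau> S \<theta> x * g x \<partial>H0_law N) \<partial>uniform_angle)"
proof -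
  interpret pair_sigma_finite uniform_angle "H0_law N" ..
  note [measurable] = measurable_planted_lik_pair[OF S, of \<tau>]
  have "(\<integral>\<^sup>+x. (\<integral>\<^sup>+\<theta>. planted_lik \<tau> S \<theta> x \<partial>uniform_angle) * g x \<partial>H0_law N)
      = (\<integral>\<^sup>+x. (\<integral>\<^sup>+\<theta>. planted_lik \<tau> S \<theta> x * g x \<partial>uniform_angle) \<partial>H0_law N)"
  proof (intro nn_integral_cong nn_integral_multc[symmetric])
    fix x assume x: "x \<in> space (H0_law N)"
    show "(\<lambda>\<theta>. planted_lik \<tau> S \<theta> x) \<in> borel_measurable uniform_angle"
      using measurable_Pair1[OF measurable_planted_lik_pair(1)[OF S, of \<tau>] x] by simp
  qed
  also have "\<dots> = (\<integral>\<^sup>+\<theta>. (\<integral>\<^sup>+x. planted_lik \<tau> S \<theta> x * g x \<partial>H0_law N) \<partial>uniform_angle)"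
    by (rule Fubini') (simp add: split_beta)
  finally show ?thesis .
qed

lemma emeasure_H1_law_mixture_lik:
  assumes \<tau>: "0 < \<tau>" "\<tau> < 1" and K: "K \<le> N" and A: "A \<in> sets (H0_law N)"
  shows "emeasure (H1_law N K \<tau>) A = (\<integral>\<^sup>+x. mixture_lik N K \<tau> x * indicator A x \<partial>H0_law N)"
proof -
  let ?F = "{S. S \<subseteq> {..<N} \<and> card S = K}"
  have [measurable]: "A \<in> sets (H0_law N)" by fact
  have fin: "finite ?F" by (rule finite_subset[of _ "Pow {..<N}"]) auto
  have m: "(\<lambda>x. (\<integral>\<^sup>+\<theta>. planted_lik \<tau> S \<theta> x \<partial>uniform_angle) * indicator A x) \<in> borel_measurable (H0_law N)"
    if "S \<in> ?F" for S
    using that A by (intro borel_measurable_times_ennreal measurable_nn_integral_planted_lik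
        borel_measurable_indicator) auto
  have "(\<integral>\<^sup>+x. mixture_lik N K \<tau> x * indicator A x \<partial>H0_law N)
      = (\<integral>\<^sup>+x. (\<Sum>S\<in>?F. (\<integral>\<^sup>+\<theta>. planted_lik \<tau> S \<theta> x \<partial>uniform_angle) * indicator A x) / of_nat (N choose K) \<partial>H0_law N)"
    by (simp only: mixture_lik_def sum_distrib_right[symmetric] divide_ennreal_def) (simp only: mult_ac)
  also have "\<dots> = (\<integral>\<^sup>+x. (\<Sum>S\<in>?F. (\<integral>\<^sup>+\<theta>. planted_lik \<tau> S \<theta> x \<partial>uniform_angle) * indicator A x) \<partial>H0_law N)
      / of_nat (N choose K)"
    by (rule nn_integral_divide) (intro borel_measurable_sum m)
  also have "(\<integral>\<^sup>+x. (\<Sum>S\<in>?F. (\<integral>\<^sup>+\<theta>. planted_lik \<tau> S \<theta> x \<partial>uniform_angle) * indicator A x) \<partial>H0_law N)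
      = (\<Sum>S\<in>?F. \<integral>\<^sup>+x. (\<integral>\<^sup>+\<theta>. planted_lik \<tau> S \<theta> x \<partial>uniform_angle) * indicator A x \<partial>H0_law N)"
    by (rule nn_integral_sum) (rule m)
  also have "\<dots> / of_nat (N choose K) = emeasure (H1_law N K \<tau>) A"
    unfolding emeasure_H1_law[OF \<tau> K A]
    by (intro arg_cong2[where f = "(/)"] sum.cong refl swap_planted_phase) auto
  finally show ?thesis ..
qed

lemma nn_integral_mixture_lik:
  assumes \<tau>: "0 < \<tau>" "\<tau> < 1" and K: "K \<le> N"
  shows "(\<integral>\<^sup>+x. mixture_lik N K \<tau> x \<partial>H0_law N) = 1"
proof -
  let ?F = "{S. S \<subseteq> {..<N} \<and> card S = K}"
  have card: "card ?F = N choose K" using n_subsets[of "{..<N}" K] by simp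
  have one: "(\<integral>\<^sup>+x. planted_lik \<tau> S \<theta> x * indicator (space (H0_law N)) x \<partial>H0_law N) = 1"
    if S: "S \<in> ?F" and \<theta>: "\<theta> \<in> {0..<2 * pi}" for S \<theta>
  proof -
    have "(\<integral>\<^sup>+x. planted_lik \<tau> S \<theta> x * indicator (space (H0_law N)) x \<partial>H0_law N)
        = (\<integral>\<^sup>+x. planted_lik \<tau> S \<theta> x * (\<Prod>i\<in>{..<N} - S. if x i \<in> circ_arc \<tau> \<theta> then 1 else 1) \<partial>H0_law N)"
      by (intro nn_integral_cong) simp
    also have "\<dots> = (1 * ennreal \<tau> + ennreal (1 - \<tau>)) ^ (N - card S)"
      using S by (intro nn_integral_planted_weight[OF \<theta> \<tau>]) simp
    also have "1 * ennreal \<tau> + ennreal (1 - \<tau>) = 1"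
      using \<tau> by (simp flip: ennreal_plus)
    finally show ?thesis by simp
  qed
  have "(\<integral>\<^sup>+x. mixture_lik N K \<tau> x \<partial>H0_law N) = emeasure (H1_law N K \<tau>) (space (H0_law N))"
    unfolding emeasure_H1_law_mixture_lik[OF \<tau> K sets.top] by (intro nn_integral_cong) simp
  also have "\<dots> = (\<Sum>S\<in>?F. \<integral>\<^sup>+\<theta>. 1 \<partial>uniform_angle) / of_nat (N choose K)"
    unfolding emeasure_H1_law[OF \<tau> K sets.top]
    by (intro arg_cong2[where f = "(/)"] sum.cong refl nn_integral_cong one) auto
  also have "\<dots> = of_nat (N choose K) / of_nat (N choose K)"
    by (simp add: card angle.emeasure_space_1 del: space_uniform_angle)
  also have "\<dots> = 1"
    using K by (intro ennreal_divide_self) (auto simp: ennreal_of_nat_eq_real_of_nat)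
  finally show ?thesis .
qed

text \<open>Expanding the square produces an average over pairs \<open>(S, S')\<close>, and Fubini moves the
integral over the data inside the integrals over the two phases.\<close>

lemma mixture_lik_second_moment:
  assumes \<tau>: "0 < \<tau>" "\<tau> \<le> 1 / 2" and K: "1 \<le> K" "K \<le> N"
  shows "(\<integral>\<^sup>+x. (mixture_lik N K \<tau> x)\<^sup>2 \<partial>H0_law N)
    \<le> ennreal (1 + 2 * real N * \<tau>\<^sup>2 / (real K)\<^sup>2 * (1 + real K / (real N * \<tau>)) ^ (K + 1))"
proof -
  let ?F = "{S. S \<subseteq> {..<N} \<and> card S = K}"
  let ?M = "of_nat (N choose K) :: ennreal"
  let ?\<delta> = "2 * real N * \<tau>\<^sup>2 / (real K)\<^sup>2 * (1 + real K / (real N * \<tau>)) ^ (K + 1)"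
  let ?l = "\<lambda>S x. \<integral>\<^sup>+\<theta>. planted_lik \<tau> S \<theta> x \<partial>uniform_angle"
  let ?f = "\<lambda>h::nat. 2 * \<tau> / (\<tau> ^ h * real (h + 1))"
  have f0: "0 \<le> ?f h" for h using \<tau> by simp
  have card: "card ?F = N choose K" using n_subsets[of "{..<N}" K] by simp
  have fin: "finite ?F" by (rule finite_subset[of _ "Pow {..<N}"]) auto
  have Mpos: "0 < real (N choose K)" using K by simp
  have l_meas: "?l S \<in> borel_measurable (H0_law N)" if "S \<in> ?F" for S
    using that by (intro measurable_nn_integral_planted_lik) simp
  have pair: "(\<integral>\<^sup>+x. ?l S x * ?l S' x \<partial>H0_law N) \<le> ennreal (1 + ?f (card (S \<inter> S')))"
    if S: "S \<in> ?F" and S': "S' \<in> ?F" for S S'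
  proof -
    have "(\<integral>\<^sup>+x. ?l S x * ?l S' x \<partial>H0_law N)
        = (\<integral>\<^sup>+\<theta>. (\<integral>\<^sup>+x. planted_lik \<tau> S \<theta> x * ?l S' x \<partial>H0_law N) \<partial>uniform_angle)"
      using S by (intro swap_planted_phase l_meas[OF S']) simp
    also have "\<dots> = (\<integral>\<^sup>+\<theta>. (\<integral>\<^sup>+\<theta>'. (\<integral>\<^sup>+x. planted_lik \<tau> S \<theta> x * planted_lik \<tau> S' \<theta>' x \<partial>H0_law N) \<partial>uniform_angle) \<partial>uniform_angle)"
    proof (intro nn_integral_cong)
      fix \<theta> assume "\<theta> \<in> space uniform_angle"
      hence \<theta>: "\<theta> \<in> {0..<2 * pi}" by simp
      have S1: "S \<subseteq> {..<N}" using S by simp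
      have m: "planted_lik \<tau> S \<theta> \<in> borel_measurable (H0_law N)"
        using measurable_planted_lik[OF S1, of "\<lambda>_. \<theta>" "H0_law N" "\<lambda>x. x" \<tau>] \<theta> by simp
      show "(\<integral>\<^sup>+x. planted_lik \<tau> S \<theta> x * ?l S' x \<partial>H0_law N)
          = (\<integral>\<^sup>+\<theta>'. (\<integral>\<^sup>+x. planted_lik \<tau> S \<theta> x * planted_lik \<tau> S' \<theta>' x \<partial>H0_law N) \<partial>uniform_angle)"
        using swap_planted_phase[OF m, of S' \<tau>] S' by (simp only: mult.commute mem_Collect_eq)
    qed
    also have "\<dots> \<le> (\<integral>\<^sup>+\<theta>. ennreal (1 + ?f (card (S \<inter> S'))) \<partial>uniform_angle)"
      using S S' \<tau> by (intro nn_integral_mono nn_integral_planted_lik_mult_le) auto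
    finally show ?thesis by (simp add: angle.emeasure_space_1 del: space_uniform_angle ennreal_plus)
  qed
  have row: "(\<Sum>S'\<in>?F. 1 + ?f (card (S \<inter> S'))) \<le> real (N choose K) * (1 + ?\<delta>)" if S: "S \<in> ?F" for S
  proof -
    have "(\<Sum>S'\<in>?F. ?f (card (S \<inter> S')))
        \<le> real (N choose K) * (\<Sum>h\<le>K. real (K choose h) * (real K / real N) ^ h * ?f h)"
      using S f0 by (intro sum_overlap_le) auto
    also have "\<dots> \<le> real (N choose K) * ?\<delta>"
      using overlap_series_le[OF \<tau>(1) K] Mpos by (intro mult_left_mono) auto
    finally show ?thesis by (simp add: sum.distrib card algebra_simps)
  qed
  have "(\<integral>\<^sup>+x. (mixture_lik N K \<tau> x)\<^sup>2 \<partial>H0_law N)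
      = (\<integral>\<^sup>+x. (\<Sum>S\<in>?F. \<Sum>S'\<in>?F. ?l S x * ?l S' x) / (?M * ?M) \<partial>H0_law N)"
    using Mpos by (intro nn_integral_cong)
      (simp add: mixture_lik_def power2_eq_square sum_product divide_ennreal_def ennreal_inverse_mult mult_ac
         ennreal_of_nat_eq_real_of_nat)
  also have "\<dots> = (\<integral>\<^sup>+x. (\<Sum>S\<in>?F. \<Sum>S'\<in>?F. ?l S x * ?l S' x) \<partial>H0_law N) / (?M * ?M)"
    using l_meas by (intro nn_integral_divide borel_measurable_sum borel_measurable_times_ennreal) auto
  also have "(\<integral>\<^sup>+x. (\<Sum>S\<in>?F. \<Sum>S'\<in>?F. ?l S x * ?l S' x) \<partial>H0_law N)
      = (\<Sum>S\<in>?F. \<Sum>S'\<in>?F. \<integral>\<^sup>+x. ?l S x * ?l S' x \<partial>H0_law N)"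
    using l_meas by (subst nn_integral_sum, intro borel_measurable_sum borel_measurable_times_ennreal, assumption, assumption)
      (intro sum.cong refl nn_integral_sum borel_measurable_times_ennreal, auto)
  also have "\<dots> / (?M * ?M) \<le> (\<Sum>S\<in>?F. \<Sum>S'\<in>?F. ennreal (1 + ?f (card (S \<inter> S')))) / (?M * ?M)"
    by (intro divide_right_mono_ennreal sum_mono pair)
  also have "(\<Sum>S\<in>?F. \<Sum>S'\<in>?F. ennreal (1 + ?f (card (S \<inter> S'))))
      = ennreal (\<Sum>S\<in>?F. \<Sum>S'\<in>?F. 1 + ?f (card (S \<inter> S')))"
    using f0 by (simp add: sum_ennreal sum_nonneg add_nonneg_nonneg del: ennreal_plus)
  also have "\<dots> / (?M * ?M) \<le> ennreal (\<Sum>S\<in>?F. real (N choose K) * (1 + ?\<delta>)) / (?M * ?M)"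
    using row by (intro divide_right_mono_ennreal ennreal_leI sum_mono)
  also have "\<dots> = ennreal (1 + ?\<delta>)"
  proof -
    have "?M * ?M = ennreal (real (N choose K) * real (N choose K))"
      by (simp add: ennreal_of_nat_eq_real_of_nat ennreal_mult)
    moreover have "0 \<le> 1 + ?\<delta>" using \<tau> by simp
    ultimately show ?thesis using Mpos by (simp only:) (subst divide_ennreal, auto simp: card)
  qed
  finally show ?thesis .
qed

text \<open>The second-moment bound is applied to the acceptance region: its probability under the alternative
is the miss probability, and under the null law it is one minus the false alarm probability.\<close>

lemma error_sum_ge:
  assumes \<tau>: "0 < \<tau>" "\<tau> \<le> 1 / 2" and K: "1 \<le> K" "K \<le> N" and \<phi>: "is_test N \<phi>"
  shows "1 - sqrt (2 * real N * \<tau>\<^sup>2 / (real K)\<^sup>2 * (1 + real K / (real N * \<tau>)) ^ (K + 1))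
    \<le> p_fa N \<phi> + p_miss N K \<tau> \<phi>"
proof -
  have \<tau>1: "\<tau> < 1" using \<tau> by simp
  let ?A = "{x \<in> space (H0_law N). \<not> \<phi> x}"
  let ?\<delta> = "2 * real N * \<tau>\<^sup>2 / (real K)\<^sup>2 * (1 + real K / (real N * \<tau>)) ^ (K + 1)"
  have [measurable]: "Measurable.pred (H0_law N) \<phi>" using \<phi> by (simp add: is_test_iff)
  have A: "?A \<in> sets (H0_law N)" by measurable
  have sp: "space (H1_law N K \<tau>) = space (H0_law N)"
    by (rule sets_eq_imp_space_eq[OF sets_H1_law[OF \<tau>(1) \<tau>1 K(2)]])
  have "measure (H0_law N) ?A - sqrt ?\<delta> \<le> enn2real (\<integral>\<^sup>+x. mixture_lik N K \<tau> x * indicator ?A x \<partial>H0_law N)"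
    using \<tau> by (intro measure_ge_of_second_moment prob_space_H0_law measurable_mixture_lik A
        nn_integral_mixture_lik \<tau>1 K mixture_lik_second_moment) auto
  also have "\<dots> = p_miss N K \<tau> \<phi>"
    unfolding p_miss_def sp measure_def emeasure_H1_law_mixture_lik[OF \<tau>(1) \<tau>1 K(2) A] ..
  finally have "measure (H0_law N) ?A - sqrt ?\<delta> \<le> p_miss N K \<tau> \<phi>" .
  moreover have "measure (H0_law N) ?A = 1 - p_fa N \<phi>"
  proof -
    have "?A = space (H0_law N) - {x \<in> space (H0_law N). \<phi> x}" by auto
    thus ?thesis unfolding p_fa_def by (simp add: H0.prob_compl)
  qed
  ultimately show ?thesis by linarith
qed

section \<open>Detection and impossibility\<close>

lemma p_fa_nonneg: "0 \<le> p_fa N \<phi>"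
  by (simp add: p_fa_def)

lemma p_miss_nonneg: "0 \<le> p_miss N K \<tau> \<phi>"
  by (simp add: p_miss_def)

text \<open>Here \<open>t\<close> is the excess of the threshold over \<open>1\<close> plus the binomial mean,
and \<open>t + d\<close> with \<open>d = 1 - \<tau>\<close> is the quantity in the hypothesis.
Passing from one to the other changes the numerator by at most twice the larger denominator, which
costs only an additive constant in the exponent.\<close>

lemma chernoff_exponent_shift:
  assumes "0 \<le> t" "0 \<le> d" "d \<le> 1" "0 < a" "a \<le> b"
  shows "(t + d)\<^sup>2 / (b + (t + d)) - 2 \<le> t\<^sup>2 / (a + t :: real)"
proof -
  have pos: "0 < a + t" "0 < b + (t + d)" using assms by auto
  have "(t + d)\<^sup>2 - 2 * (b + (t + d)) \<le> t\<^sup>2"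
  proof -
    have "d * d \<le> d * 1" using assms(2,3) by (intro mult_left_mono)
    moreover have "t * d \<le> t * 1" using assms(1,3) by (intro mult_left_mono)
    ultimately show ?thesis using assms by (simp add: power2_eq_square algebra_simps)
  qed
  hence "((t + d)\<^sup>2 - 2 * (b + (t + d))) / (b + (t + d)) \<le> t\<^sup>2 / (b + (t + d))"
    using pos by (intro divide_right_mono) auto
  moreover have "2 * (b + (t + d)) / (b + (t + d)) = 2"
    by (rule nonzero_mult_div_cancel_right) (use pos in simp)
  ultimately have "(t + d)\<^sup>2 / (b + (t + d)) - 2 \<le> t\<^sup>2 / (b + (t + d))"
    by (simp only: diff_divide_distrib)
  also have "\<dots> \<le> t\<^sup>2 / (a + t)"
    using assms pos by (intro divide_left_mono) auto
  finally show ?thesis .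
qed

lemma full_count_strong_detection:
  fixes K :: "nat \<Rightarrow> nat" and \<tau> :: "nat \<Rightarrow> real"
  assumes K: "\<And>N. N \<ge> 1 \<Longrightarrow> 1 \<le> K N \<and> K N \<le> N"
    and \<tau>: "\<And>N. N \<ge> 1 \<Longrightarrow> 0 < \<tau> N \<and> \<tau> N < 1"
    and lim: "(\<lambda>N. real N ^ K N * \<tau> N ^ (K N - 1) / fact (K N - 1)) \<longlonglongrightarrow> 0"
  shows "strong_detection K \<tau> (\<lambda>N. interval_test N (\<tau> N) (real (K N)))"
  unfolding strong_detection_def
proof (intro conjI allI is_test_interval_test)
  have ev: "\<forall>\<^sub>F N in sequentially. 1 \<le> (N::nat)" by (rule eventually_ge_at_top)
  show "(\<lambda>N. p_fa N (interval_test N (\<tau> N) (real (K N)))) \<longlonglongrightarrow> 0"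
  proof (rule tendsto_sandwich[OF _ _ tendsto_const lim])
    show "\<forall>\<^sub>F N in sequentially. p_fa N (interval_test N (\<tau> N) (real (K N)))
        \<le> real N ^ K N * \<tau> N ^ (K N - 1) / fact (K N - 1)"
      using ev by eventually_elim (use K \<tau> in \<open>intro p_fa_full_count, auto\<close>)
  qed (simp add: p_fa_nonneg)
  show "(\<lambda>N. p_miss N (K N) (\<tau> N) (interval_test N (\<tau> N) (real (K N)))) \<longlonglongrightarrow> 0"
  proof (rule tendsto_sandwich[OF _ _ tendsto_const tendsto_const])
    show "\<forall>\<^sub>F N in sequentially. p_miss N (K N) (\<tau> N) (interval_test N (\<tau> N) (real (K N))) \<le> 0"
      using ev by eventually_elim (use K \<tau> in \<open>intro p_miss_full_count, auto\<close>)
  qed (simp add: p_miss_nonneg)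
qed

lemma chernoff_strong_detection:
  fixes K :: "nat \<Rightarrow> nat" and \<tau> c \<gamma> :: "nat \<Rightarrow> real"
  assumes K: "\<And>N. N \<ge> 1 \<Longrightarrow> 1 \<le> K N \<and> K N \<le> N"
    and \<tau>: "\<And>N. N \<ge> 1 \<Longrightarrow> 0 < \<tau> N \<and> \<tau> N < 1"
    and c: "filterlim c at_top sequentially"
    and \<gamma>: "\<And>N. N \<ge> 1 \<Longrightarrow> \<gamma> N = (real N - real (K N)) * \<tau> N + real (K N)
                        - c N * sqrt ((real N - real (K N)) * \<tau> N)"
    and \<gamma>_ge: "\<forall>\<^sub>F N in sequentially. \<gamma> N \<ge> 1 + (real N - 1) * \<tau> N"
    and lim: "filterlim (\<lambda>N.
            (real (K N) * (1 - \<tau> N) - c N * sqrt ((real N - real (K N)) * \<tau> N))\<^sup>2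
            / (2 * real N * \<tau> N + real (K N) * (1 - \<tau> N)
                - c N * sqrt ((real N - real (K N)) * \<tau> N))
            - ln (real N)) at_top sequentially"
  shows "strong_detection K \<tau> (\<lambda>N. interval_test N (\<tau> N) (\<gamma> N))"
  unfolding strong_detection_def
proof (intro conjI allI is_test_interval_test)
  define u where "u N = real (K N) * (1 - \<tau> N) - c N * sqrt ((real N - real (K N)) * \<tau> N)" for N
  define G where "G N = (u N)\<^sup>2 / (2 * real N * \<tau> N + u N) - ln (real N)" for N
  have G: "filterlim G at_top sequentially"
    using lim unfolding G_def u_def by (simp add: add_diff_eq)
  have exp_lim: "(\<lambda>N. exp (2 - G N)) \<longlonglongrightarrow> 0"
  proof -
    have "filterlim (\<lambda>N. - 2 + G N) at_top sequentially"
      by (intro filterlim_tendsto_add_at_top[OF tendsto_const] G)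
    from filterlim_compose[OF exp_at_bot filterlim_uminus_at_bot_at_top[THEN filterlim_compose, OF this]]
    show ?thesis by simp
  qed
  have ev: "\<forall>\<^sub>F N in sequentially. 2 \<le> (N::nat)" by (rule eventually_ge_at_top)
  show "(\<lambda>N. p_fa N (interval_test N (\<tau> N) (\<gamma> N))) \<longlonglongrightarrow> 0"
  proof (rule tendsto_sandwich[OF _ _ tendsto_const exp_lim])
    show "\<forall>\<^sub>F N in sequentially. p_fa N (interval_test N (\<tau> N) (\<gamma> N)) \<le> exp (2 - G N)"
      using ev \<gamma>_ge
    proof eventually_elim
      fix N :: nat assume N: "2 \<le> N" and ge: "\<gamma> N \<ge> 1 + (real N - 1) * \<tau> N"
      have \<tau>N: "0 < \<tau> N" "\<tau> N < 1" using \<tau>[of N] N by auto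
      define t where "t = \<gamma> N - (1 + (real N - 1) * \<tau> N)"
      have t: "0 \<le> t" using ge by (simp add: t_def)
      have ut: "u N = t + (1 - \<tau> N)"
        using \<gamma>[of N] N by (simp add: t_def u_def algebra_simps)
      have "p_fa N (interval_test N (\<tau> N) (\<gamma> N))
          = p_fa N (interval_test N (\<tau> N) (1 + (real N - 1) * \<tau> N + t))" by (simp add: t_def)
      also have "\<dots> \<le> real N * exp (- (t\<^sup>2 / (2 * ((real N - 1) * \<tau> N) + t)))"
        by (rule p_fa_chernoff[OF \<tau>N N t])
      also have "(u N)\<^sup>2 / (2 * real N * \<tau> N + u N) - 2 \<le> t\<^sup>2 / (2 * ((real N - 1) * \<tau> N) + t)"
        unfolding ut using t \<tau>N N by (intro chernoff_exponent_shift) auto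
      hence "real N * exp (- (t\<^sup>2 / (2 * ((real N - 1) * \<tau> N) + t)))
          \<le> real N * exp (2 - (u N)\<^sup>2 / (2 * real N * \<tau> N + u N))"
        by (intro mult_left_mono) auto
      also have "\<dots> = exp (ln (real N)) * exp (2 - (u N)\<^sup>2 / (2 * real N * \<tau> N + u N))"
        using N by simp
      also have "\<dots> = exp (2 - G N)"
        unfolding G_def exp_add[symmetric] by (simp add: algebra_simps)
      finally show "p_fa N (interval_test N (\<tau> N) (\<gamma> N)) \<le> exp (2 - G N)" .
    qed
  qed (simp add: p_fa_nonneg)
  have exp_lim2: "(\<lambda>N. exp (- ((c N)\<^sup>2 / 2))) \<longlonglongrightarrow> 0"
  proof -
    have "filterlim (\<lambda>x::real. exp (- (x\<^sup>2 / 2))) (nhds 0) at_top" by real_asymp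
    thus ?thesis by (rule filterlim_compose[OF _ c])
  qed
  show "(\<lambda>N. p_miss N (K N) (\<tau> N) (interval_test N (\<tau> N) (\<gamma> N))) \<longlonglongrightarrow> 0"
  proof (rule tendsto_sandwich[OF _ _ tendsto_const exp_lim2])
    show "\<forall>\<^sub>F N in sequentially. p_miss N (K N) (\<tau> N) (interval_test N (\<tau> N) (\<gamma> N)) \<le> exp (- ((c N)\<^sup>2 / 2))"
      using ev filterlim_at_top[THEN iffD1, OF c, rule_format, of 0]
    proof eventually_elim
      fix N :: nat assume N: "2 \<le> N" and c: "0 \<le> c N"
      hence "1 \<le> N" by simp
      thus "p_miss N (K N) (\<tau> N) (interval_test N (\<tau> N) (\<gamma> N)) \<le> exp (- ((c N)\<^sup>2 / 2))"
        unfolding \<gamma>[OF \<open>1 \<le> N\<close>] using K \<tau> c by (intro p_miss_chernoff) auto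
    qed
  qed (simp add: p_miss_nonneg)
qed

lemma weak_detection_impossibleI:
  fixes K :: "nat \<Rightarrow> nat" and \<tau> :: "nat \<Rightarrow> real"
  assumes K: "\<And>N. N \<ge> 1 \<Longrightarrow> 1 \<le> K N \<and> K N \<le> N"
    and \<tau>: "\<And>N. N \<ge> 1 \<Longrightarrow> 0 < \<tau> N \<and> \<tau> N < 1"
    and half: "\<forall>\<^sub>F N in sequentially. \<tau> N \<le> 1 / 2"
    and lim: "(\<lambda>N. 2 * real N * (\<tau> N)\<^sup>2 / (real (K N))\<^sup>2
                * (1 + real (K N) / (real N * \<tau> N)) ^ (K N + 1)) \<longlonglongrightarrow> 0" (is "?\<delta> \<longlonglongrightarrow> 0")
  shows "weak_detection_impossible K \<tau>"
  unfolding weak_detection_impossible_def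
proof (intro allI impI)
  fix \<phi> :: "nat \<Rightarrow> (nat \<Rightarrow> real) \<Rightarrow> bool" assume \<phi>: "\<forall>N. is_test N (\<phi> N)"
  define r where "r N = max 0 (1 - (p_fa N (\<phi> N) + p_miss N (K N) (\<tau> N) (\<phi> N)))" for N
  have sqrt_lim: "(\<lambda>N. sqrt (?\<delta> N)) \<longlonglongrightarrow> 0"
    using tendsto_real_sqrt[OF lim] by simp
  have "r \<longlonglongrightarrow> 0"
  proof (rule tendsto_sandwich[OF _ _ tendsto_const sqrt_lim])
    show "\<forall>\<^sub>F N in sequentially. r N \<le> sqrt (?\<delta> N)"
      using half eventually_ge_at_top[of 1]
    proof eventually_elim
      fix N :: nat assume N: "\<tau> N \<le> 1 / 2" "1 \<le> N"
      have "1 - sqrt (?\<delta> N) \<le> p_fa N (\<phi> N) + p_miss N (K N) (\<tau> N) (\<phi> N)"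
        using N K \<tau> \<phi> by (intro error_sum_ge) auto
      moreover have "0 \<le> sqrt (?\<delta> N)" using \<tau>[OF N(2)] by simp
      ultimately show "r N \<le> sqrt (?\<delta> N)" by (simp add: r_def)
    qed
  qed (simp add: r_def)
  moreover have "\<forall>N\<ge>1. 1 - r N \<le> p_fa N (\<phi> N) + p_miss N (K N) (\<tau> N) (\<phi> N)"
    by (auto simp: r_def)
  ultimately show "\<exists>r. r \<longlonglongrightarrow> 0 \<and> (\<forall>N\<ge>1. p_fa N (\<phi> N) + p_miss N (K N) (\<tau> N) (\<phi> N) \<ge> 1 - r N)"
    by blast
qed

theorem theorem1:
  fixes K :: "nat \<Rightarrow> nat" and \<tau> :: "nat \<Rightarrow> real"
  assumes K: "\<And>N. N \<ge> 1 \<Longrightarrow> 1 \<le> K N \<and> K N \<le> N"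
    and \<tau>: "\<And>N. N \<ge> 1 \<Longrightarrow> 0 < \<tau> N \<and> \<tau> N < 1"
  shows
    "((\<lambda>N. real N ^ K N * \<tau> N ^ (K N - 1) / fact (K N - 1)) \<longlonglongrightarrow> 0
       \<longrightarrow> strong_detection K \<tau> (\<lambda>N. interval_test N (\<tau> N) (real (K N))))
     \<and>
     (\<forall>c \<gamma> :: nat \<Rightarrow> real.
         filterlim c at_top sequentially
       \<and> (\<forall>N\<ge>1. \<gamma> N = (real N - real (K N)) * \<tau> N + real (K N)
                        - c N * sqrt ((real N - real (K N)) * \<tau> N))
       \<and> (\<forall>\<^sub>F N in sequentially. \<gamma> N \<ge> 1 + (real N - 1) * \<tau> N)
       \<and> ((\<lambda>N. ereal ((real (K N) - 1)\<^sup>2 * (1 - \<tau> N)\<^sup>2)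
                  / ereal ((real N - real (K N)) * \<tau> N)) \<longlonglongrightarrow> \<infinity>)
       \<and> filterlim (\<lambda>N.
            (real (K N) * (1 - \<tau> N) - c N * sqrt ((real N - real (K N)) * \<tau> N))\<^sup>2
            / (2 * real N * \<tau> N + real (K N) * (1 - \<tau> N)
                - c N * sqrt ((real N - real (K N)) * \<tau> N))
            - ln (real N)) at_top sequentially
       \<longrightarrow> strong_detection K \<tau> (\<lambda>N. interval_test N (\<tau> N) (\<gamma> N)))
     \<and>
     ((\<forall>\<^sub>F N in sequentially. \<tau> N \<le> 1 / 2)
       \<and> (\<lambda>N. 2 * real N * (\<tau> N)\<^sup>2 / (real (K N))\<^sup>2
                * (1 + real (K N) / (real N * \<tau> N)) ^ (K N + 1)) \<longlonglongrightarrow> 0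
       \<longrightarrow> weak_detection_impossible K \<tau>)"
proof (intro conjI impI allI)
  assume "(\<lambda>N. real N ^ K N * \<tau> N ^ (K N - 1) / fact (K N - 1)) \<longlonglongrightarrow> 0"
  thus "strong_detection K \<tau> (\<lambda>N. interval_test N (\<tau> N) (real (K N)))"
    by (intro full_count_strong_detection K \<tau>)
next
  fix c \<gamma> :: "nat \<Rightarrow> real"
  assume "filterlim c at_top sequentially
       \<and> (\<forall>N\<ge>1. \<gamma> N = (real N - real (K N)) * \<tau> N + real (K N)
                        - c N * sqrt ((real N - real (K N)) * \<tau> N))
       \<and> (\<forall>\<^sub>F N in sequentially. \<gamma> N \<ge> 1 + (real N - 1) * \<tau> N)
       \<and> ((\<lambda>N. ereal ((real (K N) - 1)\<^sup>2 * (1 - \<tau> N)\<^sup>2)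
                  / ereal ((real N - real (K N)) * \<tau> N)) \<longlonglongrightarrow> \<infinity>)
       \<and> filterlim (\<lambda>N.
            (real (K N) * (1 - \<tau> N) - c N * sqrt ((real N - real (K N)) * \<tau> N))\<^sup>2
            / (2 * real N * \<tau> N + real (K N) * (1 - \<tau> N)
                - c N * sqrt ((real N - real (K N)) * \<tau> N))
            - ln (real N)) at_top sequentially"
  thus "strong_detection K \<tau> (\<lambda>N. interval_test N (\<tau> N) (\<gamma> N))"
    by (elim conjE) (rule chernoff_strong_detection[OF K \<tau>], auto)
next
  assume "(\<forall>\<^sub>F N in sequentially. \<tau> N \<le> 1 / 2)
       \<and> (\<lambda>N. 2 * real N * (\<tau> N)\<^sup>2 / (real (K N))\<^sup>2
                * (1 + real (K N) / (real N * \<tau> N)) ^ (K N + 1)) \<longlonglongrightarrow> 0"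
  thus "weak_detection_impossible K \<tau>"
    by (elim conjE) (intro weak_detection_impossibleI K \<tau>)
qed

end
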